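(* Let $p\in[1,2)$ be a constant. For all $n,d$ there exists an oblivious $\ell_p$ subspace embedding distribution $\mathcal D$ over matrices $S\in\mathbb R^{r\times n}$ with distortion $\kappa=O(d(\log d)(\log\log d))^{1/p}=\tilde O(d^{1/p})$ and $r=O(d\log d)$. That is, for every $A\in\mathbb R^{n\times d}$, $$\Pr_{S\sim\mathcal D}\Big\{\text{for all }x\in\mathbb R^d,\ \|Ax\|_p\le\|SAx\|_p\le\kappa\|Ax\|_p\Big\}\ge\frac{99}{100}.$$
   Context: The distribution $\mathcal D$ does not depend on $A$ (only on $n,d,p$). $\tilde O$ hides polylogarithmic factors in $d$; constants may depend on $p$. (Iterated) logarithms in bounds are read as at least $1$. *)

theory Defs
  imports "HOL-Probability.Probability" "Jordan_Normal_Form.Matrix"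
begin

definition lp_norm :: "real \<Rightarrow> real Matrix.vec \<Rightarrow> real" where
  "lp_norm p v = (\<Sum>i<dim_vec v. \<bar>vec_index v i\<bar> powr p) powr (1 / p)"

(* The Borel sigma-algebra on real r x n matrices, pulled back from the product
   sigma-algebra along the bijection between matrices and their entry families. *)
definition borel_mat :: "nat \<Rightarrow> nat \<Rightarrow> real mat measure" where
  "borel_mat r n = vimage_algebra (carrier_mat r n)
     (\<lambda>S. \<lambda>ij\<in>{..<r} \<times> {..<n}. S $$ ij)
     (\<Pi>\<^sub>M ij\<in>{..<r} \<times> {..<n}. (borel :: real measure))"

(* The law D is fixed before A is quantified: this is obliviousness. The event is closed
   for p >= 1, hence measurable. *)
definition oblivious_lp_subspace_embedding ::
    "real \<Rightarrow> nat \<Rightarrow> nat \<Rightarrow> nat \<Rightarrow> real \<Rightarrow> real mat measure \<Rightarrow> bool" where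
  "oblivious_lp_subspace_embedding p n d r \<kappa> D \<longleftrightarrow>
     prob_space D \<and> space D = carrier_mat r n \<and> sets D = sets (borel_mat r n) \<and>
     (\<forall>A \<in> carrier_mat n d.
        measure D {S \<in> space D. \<forall>x \<in> carrier_vec d.
            lp_norm p (A *\<^sub>v x) \<le> lp_norm p (S * A *\<^sub>v x) \<and>
            lp_norm p (S * A *\<^sub>v x) \<le> \<kappa> * lp_norm p (A *\<^sub>v x)} \<ge> 99 / 100)"

(* Logarithm truncated from below at 1; log log d is log1 (log1 d). *)
definition log1 :: "real \<Rightarrow> real" where
  "log1 t = max 1 (ln t)"

end

theory Submission
  imports Defs "HOL-Real_Asymp.Real_Asymp"
begin

text \<open>The entries of the sketch are independent and symmetric with tails
  \<open>Pr(|X|^p \<ge> s) \<approx> 1/s\<close>, up to a scalar; exact \<open>p\<close>-stability is never used.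

  Dilation: a change of basis by approximate Lewis weights turns \<open>A x\<close> into \<open>B y\<close> with \<open>|y|_2\<close> at most
  \<open>O(|A x|_p)\<close> and rows \<open>b_k\<close> satisfying \<open>\<Sum>k. |b_k|_2^p = O(d)\<close>. By Cauchy-Schwarz
  \<open>|S A x|_p^p \<le> |y|_2^p (\<Sum>i. |s_i B|_2^p)\<close>, and the inner sum has \<open>r\<close> independent terms
  with tails \<open>O(d/s)\<close>, so it is \<open>O(r d log r)\<close> with high probability.

  Contraction: each row satisfies \<open>|s_i z| \<ge> |z|_p\<close> with constant probability, by Levy's sign-flipping
  argument, so a Chernoff bound gives \<open>|S z|_p^p \<ge> \<Omega>(r) |z|_p^p\<close> outside an event of probability
  \<open>exp(-\<Omega>(r))\<close>. For \<open>r\<close> of order \<open>d log d\<close> this survives a union bound over a grid of mesh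
  \<open>1/poly(d)\<close>, and the dilation bound extends it to all vectors.\<close>

section \<open>Leverage scores and Lewis weights\<close>

text \<open>The p-th absolute moment of a single unscaled entry is the harmonic number of
  \<open>N = 2 * n\<close>, so a first-moment bound on the dilation would put log n into the
  distortion. Truncating the row norms at a level of order r d leaves J = O(log r) dyadic layers of
  equal weight instead, and this J is the logarithm in the distortion. The basis must serve two
  purposes at once, small row norms and control of |y|_2 by |A x|_p, with constants free of n; Lewis
  weights balance the two, and weights correct up to a factor 2 are enough.

  The parameters look circular: the mesh must beat the dilation bound, which contains log r, while r
  must beat d times the logarithm of the inverse mesh. This closes because the inverse mesh is of
  order d^2 log r, so r returns only through an iterated logarithm.

  Sampling from a finite set makes every function on the sample space integrable and every event
  measurable; measurability remains to be shown only for the event on matrices.\<close>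

lemma weighted_orthonormal_basis:
  fixes a :: "'k \<Rightarrow> nat \<Rightarrow> real" and v :: "'k \<Rightarrow> real"
  assumes "finite K" and v: "\<And>k. k \<in> K \<Longrightarrow> v k > 0"
  shows "\<exists>m u. m \<le> d
    \<and> (\<forall>i<m. \<exists>x. \<forall>k\<in>K. u i k = (\<Sum>j<d. x j * a k j))
    \<and> (\<forall>i<m. \<forall>j<m. (\<Sum>k\<in>K. v k * u i k * u j k) = (if i = j then 1 else 0))
    \<and> (\<forall>x. \<exists>y. \<forall>k\<in>K. (\<Sum>j<d. x j * a k j) = (\<Sum>i<m. y i * u i k))"
proof (induction d)
  case 0
  show ?case by (intro exI[of _ 0]) auto
next
  case (Suc d)
  then obtain m u where m: "m \<le> d"
    and span: "\<And>i. i < m \<Longrightarrow> \<exists>x. \<forall>k\<in>K. u i k = (\<Sum>j<d. x j * a k j)"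
    and orth: "\<And>i j. i < m \<Longrightarrow> j < m \<Longrightarrow> (\<Sum>k\<in>K. v k * u i k * u j k) = (if i = j then 1 else 0)"
    and repr: "\<And>x. \<exists>y. \<forall>k\<in>K. (\<Sum>j<d. x j * a k j) = (\<Sum>i<m. y i * u i k)"
    by blast
  obtain X where X: "\<And>i k. i < m \<Longrightarrow> k \<in> K \<Longrightarrow> u i k = (\<Sum>j<d. X i j * a k j)"
    using span by metis
  \<comment> \<open>Gram-Schmidt step for the inner product weighted by \<open>v\<close>:
    \<open>g\<close> is the new column minus its projection to the span of the vectors found so
    far.\<close>
  define c where "c i = (\<Sum>k\<in>K. v k * a k d * u i k)" for i
  define g where "g k = a k d - (\<Sum>i<m. c i * u i k)" for k
  define G where "G = (\<Sum>k\<in>K. v k * g k * g k)"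
  have g_orth: "(\<Sum>k\<in>K. v k * g k * u j k) = 0" if "j < m" for j
  proof -
    have "(\<Sum>k\<in>K. v k * g k * u j k)
        = c j - (\<Sum>k\<in>K. \<Sum>i<m. c i * (v k * u i k * u j k))"
      by (simp add: g_def c_def algebra_simps sum_subtractf sum_distrib_left)
    also have "(\<Sum>k\<in>K. \<Sum>i<m. c i * (v k * u i k * u j k))
        = (\<Sum>i<m. c i * (\<Sum>k\<in>K. v k * u i k * u j k))"
      by (subst sum.swap) (simp add: sum_distrib_left)
    also have "\<dots> = (\<Sum>i<m. if i = j then c i else 0)"
      using that by (intro sum.cong) (auto simp: orth)
    finally show ?thesis using that by simp
  qed
  have lift: "\<exists>x. \<forall>k\<in>K. (\<Sum>j<d. z j * a k j) + \<alpha> * a k d = (\<Sum>j<Suc d. x j * a k j)" for z \<alpha>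
    by (intro exI[of _ "z(d := \<alpha>)"]) auto
  have G_nonneg: "G \<ge> 0" unfolding G_def using v
    by (intro sum_nonneg) (simp add: less_imp_le mult.assoc)
  show ?case
  proof (cases "G = 0")
    \<comment> \<open>The new column already lies in the span, so \<open>m\<close> stays as it is.
      This is how rank-deficient matrices are covered.\<close>
    case True
    have "g k = 0" if "k \<in> K" for k
    proof -
      have "\<forall>k\<in>K. v k * g k * g k = 0"
        using True \<open>finite K\<close> v unfolding G_def
        by (subst (asm) sum_nonneg_eq_0_iff) (auto simp: less_imp_le mult.assoc)
      with that v[OF that] show ?thesis by auto
    qed
    then have ad: "a k d = (\<Sum>i<m. c i * u i k)" if "k \<in> K" for k
      using that by (simp add: g_def)
    show ?thesis
    proof (intro exI[of _ m] exI[of _ u] conjI allI impI)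
      show "m \<le> Suc d" using m by simp
      fix i assume "i < m"
      then show "\<exists>x. \<forall>k\<in>K. u i k = (\<Sum>j<Suc d. x j * a k j)"
        using lift[of "X i" 0] X by simp
    next
      fix x
      obtain y where "\<forall>k\<in>K. (\<Sum>j<d. x j * a k j) = (\<Sum>i<m. y i * u i k)"
        using repr by blast
      then show "\<exists>y. \<forall>k\<in>K. (\<Sum>j<Suc d. x j * a k j) = (\<Sum>i<m. y i * u i k)"
        by (intro exI[of _ "\<lambda>i. y i + x d * c i"])
          (simp add: ad distrib_right sum.distrib sum_distrib_left mult.assoc)
    qed (use orth in auto)
  next
    case False
    with G_nonneg have Gpos: "G > 0" by simp
    define w where "w k = g k / sqrt G" for k
    define u' where "u' = u(m := w)"
    have ww: "(\<Sum>k\<in>K. v k * w k * w k) = 1"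
    proof -
      have "(\<Sum>k\<in>K. v k * w k * w k) = G / (sqrt G * sqrt G)"
        unfolding w_def G_def sum_divide_distrib by (intro sum.cong) simp_all
      then show ?thesis using Gpos by simp
    qed
    have wu: "(\<Sum>k\<in>K. v k * w k * u j k) = 0" if "j < m" for j
    proof -
      have "(\<Sum>k\<in>K. v k * w k * u j k) = (\<Sum>k\<in>K. v k * g k * u j k) / sqrt G"
        unfolding w_def sum_divide_distrib by (intro sum.cong) simp_all
      then show ?thesis using g_orth[OF that] by simp
    qed
    have uw: "(\<Sum>k\<in>K. v k * u j k * w k) = 0" if "j < m" for j
      using wu[OF that] by (simp add: mult_ac)
    have w_repr: "a k d = sqrt G * w k + (\<Sum>i<m. c i * u i k)" for k
      using Gpos by (simp add: w_def g_def)
    show ?thesis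
    proof (intro exI[of _ "Suc m"] exI[of _ u'] conjI allI impI)
      show "Suc m \<le> Suc d" using m by simp
    next
      fix i assume "i < Suc m"
      show "\<exists>x. \<forall>k\<in>K. u' i k = (\<Sum>j<Suc d. x j * a k j)"
      proof (cases "i = m")
        case True
        define s where "s j = (\<Sum>i<m. c i * X i j)" for j
        have "(\<Sum>j<d. (- s j / sqrt G) * a k j) + (1 / sqrt G) * a k d = w k"
          if "k \<in> K" for k
        proof -
          have "(\<Sum>i<m. c i * u i k) = (\<Sum>i<m. \<Sum>j<d. c i * X i j * a k j)"
            using that by (simp add: X sum_distrib_left mult_ac)
          also have "\<dots> = (\<Sum>j<d. s j * a k j)"
            by (subst sum.swap) (simp add: sum_distrib_right s_def)
          finally show ?thesis
            by (simp add: w_def g_def diff_divide_distrib sum_divide_distrib sum_negf)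
        qed
        then show ?thesis
          using lift[of "\<lambda>j. - s j / sqrt G" "1 / sqrt G"] True
          by (simp add: u'_def)
      next
        case False
        with \<open>i < Suc m\<close> show ?thesis
          using lift[of "X i" 0] X by (simp add: u'_def)
      qed
    next
      fix i j assume "i < Suc m" "j < Suc m"
      then show "(\<Sum>k\<in>K. v k * u' i k * u' j k) = (if i = j then 1 else 0)"
        by (auto simp: u'_def ww wu uw orth less_Suc_eq)
    next
      fix x
      obtain y where y: "\<forall>k\<in>K. (\<Sum>j<d. x j * a k j) = (\<Sum>i<m. y i * u i k)"
        using repr by blast
      have "(\<Sum>j<Suc d. x j * a k j)
          = (\<Sum>i<Suc m. (if i = m then x d * sqrt G else y i + x d * c i) * u' i k)"
        if "k \<in> K" for k
      proof -
        have "(\<Sum>i<m. (if i = m then x d * sqrt G else y i + x d * c i) * u' i k)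
            = (\<Sum>i<m. (y i + x d * c i) * u i k)"
          by (intro sum.cong) (auto simp: u'_def)
        also have "\<dots> = (\<Sum>i<m. y i * u i k) + x d * (\<Sum>i<m. c i * u i k)"
          by (simp add: distrib_right sum.distrib sum_distrib_left mult.assoc)
        finally show ?thesis
          using that y by (simp add: u'_def w_repr[of k] distrib_left mult.assoc)
      qed
      then show "\<exists>y. \<forall>k\<in>K. (\<Sum>j<Suc d. x j * a k j) = (\<Sum>i<Suc m. y i * u' i k)"
        by (intro exI[of _ "\<lambda>i. if i = m then x d * sqrt G else y i + x d * c i"]) blast
    qed
  qed
qed

text \<open>The function \<open>t\<close> below consists of the leverage scores of the rows of \<open>a\<close> divided by
  the weights \<open>v\<close>; equivalently \<open>t k\<close> is the maximum of the squared \<open>k\<close>-th entry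
  over the unit ball of the weighted 2-norm on the column span.\<close>

definition is_leverage :: "nat \<Rightarrow> 'k set \<Rightarrow> ('k \<Rightarrow> nat \<Rightarrow> real) \<Rightarrow> ('k \<Rightarrow> real) \<Rightarrow> ('k \<Rightarrow> real) \<Rightarrow> bool"
  where "is_leverage d K a v t \<longleftrightarrow>
    (\<forall>x. \<forall>k\<in>K. (\<Sum>j<d. x j * a k j)\<^sup>2 \<le> t k * (\<Sum>l\<in>K. v l * (\<Sum>j<d. x j * a l j)\<^sup>2)) \<and>
    (\<forall>k\<in>K. \<exists>x. (\<Sum>j<d. x j * a k j) = t k \<and> (\<Sum>l\<in>K. v l * (\<Sum>j<d. x j * a l j)\<^sup>2) = t k)"

text \<open>Row \<open>b k\<close> collects the values at \<open>k\<close> of a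
  \<open>v\<close>-orthonormal basis of the column span. Parseval turns the weighted 2-norm into the
  Euclidean one, Cauchy-Schwarz makes the squared row norms the leverage, and their
  \<open>v\<close>-weighted sum counts the \<open>m\<close> basis vectors, as the trace of a
  projection does.\<close>

lemma leverage_basis:
  fixes a :: "'k \<Rightarrow> nat \<Rightarrow> real" and v :: "'k \<Rightarrow> real"
  assumes K: "finite K" and v: "\<And>k. k \<in> K \<Longrightarrow> v k > 0"
  shows "\<exists>m b. m \<le> d
    \<and> (\<forall>x. \<exists>y. (\<forall>k\<in>K. (\<Sum>j<d. x j * a k j) = (\<Sum>i<m. y i * b k i))
          \<and> (\<Sum>i<m. (y i)\<^sup>2) = (\<Sum>k\<in>K. v k * (\<Sum>j<d. x j * a k j)\<^sup>2))
    \<and> is_leverage d K a v (\<lambda>k. \<Sum>i<m. (b k i)\<^sup>2)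
    \<and> (\<Sum>k\<in>K. v k * (\<Sum>i<m. (b k i)\<^sup>2)) \<le> real d"
proof -
  obtain m u where m: "m \<le> d"
    and span: "\<And>i. i < m \<Longrightarrow> \<exists>x. \<forall>k\<in>K. u i k = (\<Sum>j<d. x j * a k j)"
    and orth: "\<And>i j. i < m \<Longrightarrow> j < m \<Longrightarrow> (\<Sum>k\<in>K. v k * u i k * u j k) = (if i = j then 1 else 0)"
    and repr: "\<And>x. \<exists>y. \<forall>k\<in>K. (\<Sum>j<d. x j * a k j) = (\<Sum>i<m. y i * u i k)"
    using weighted_orthonormal_basis[OF K, of v d a] v by blast
  obtain X where X: "\<And>i k. i < m \<Longrightarrow> k \<in> K \<Longrightarrow> u i k = (\<Sum>j<d. X i j * a k j)"
    using span by metis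
  have parseval: "(\<Sum>k\<in>K. v k * (\<Sum>i<m. y i * u i k)\<^sup>2) = (\<Sum>i<m. (y i)\<^sup>2)" for y
  proof -
    have "(\<Sum>k\<in>K. v k * (\<Sum>i<m. y i * u i k)\<^sup>2)
        = (\<Sum>k\<in>K. \<Sum>i<m. \<Sum>j<m. y i * y j * (v k * u i k * u j k))"
      by (simp add: power2_eq_square sum_product sum_distrib_left mult_ac)
    also have "\<dots> = (\<Sum>i<m. \<Sum>j<m. \<Sum>k\<in>K. y i * y j * (v k * u i k * u j k))"
      by (subst sum.swap, rule sum.cong[OF refl], subst sum.swap, rule refl)
    also have "\<dots> = (\<Sum>i<m. \<Sum>j<m. y i * y j * (\<Sum>k\<in>K. v k * u i k * u j k))"
      by (simp add: sum_distrib_left)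
    also have "\<dots> = (\<Sum>i<m. \<Sum>j<m. if i = j then y i * y j else 0)"
      by (intro sum.cong refl) (auto simp: orth)
    also have "\<dots> = (\<Sum>i<m. (y i)\<^sup>2)"
      by (intro sum.cong refl) (simp add: power2_eq_square)
    finally show ?thesis .
  qed
  define t where "t k = (\<Sum>i<m. (u i k)\<^sup>2)" for k
  have R: "\<exists>y. (\<forall>k\<in>K. (\<Sum>j<d. x j * a k j) = (\<Sum>i<m. y i * u i k))
          \<and> (\<Sum>i<m. (y i)\<^sup>2) = (\<Sum>k\<in>K. v k * (\<Sum>j<d. x j * a k j)\<^sup>2)" for x
  proof -
    obtain y where y: "\<forall>k\<in>K. (\<Sum>j<d. x j * a k j) = (\<Sum>i<m. y i * u i k)"
      using repr by blast
    then have "(\<Sum>k\<in>K. v k * (\<Sum>j<d. x j * a k j)\<^sup>2) = (\<Sum>k\<in>K. v k * (\<Sum>i<m. y i * u i k)\<^sup>2)"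
      by (intro sum.cong) auto
    with y parseval show ?thesis by auto
  qed
  have lev: "is_leverage d K a v t"
    unfolding is_leverage_def
  proof (intro conjI allI ballI)
    fix x k assume k: "k \<in> K"
    obtain y where y: "(\<Sum>j<d. x j * a k j) = (\<Sum>i<m. y i * u i k)"
      and y2: "(\<Sum>i<m. (y i)\<^sup>2) = (\<Sum>k\<in>K. v k * (\<Sum>j<d. x j * a k j)\<^sup>2)"
      using R k by blast
    show "(\<Sum>j<d. x j * a k j)\<^sup>2 \<le> t k * (\<Sum>l\<in>K. v l * (\<Sum>j<d. x j * a l j)\<^sup>2)"
      using Cauchy_Schwarz_ineq_sum[of y "\<lambda>i. u i k" "{..<m}"]
      by (simp add: y y2[symmetric] t_def mult.commute)
  next
    fix k assume k: "k \<in> K"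
    \<comment> \<open>Equality case of Cauchy-Schwarz: the coordinate vector is row \<open>k\<close>
      itself, pulled back to the original columns through \<open>X\<close>.\<close>
    define x where "x j = (\<Sum>i<m. u i k * X i j)" for j
    have *: "(\<Sum>j<d. x j * a l j) = (\<Sum>i<m. u i k * u i l)" if "l \<in> K" for l
    proof -
      have "(\<Sum>i<m. u i k * u i l) = (\<Sum>i<m. \<Sum>j<d. u i k * X i j * a l j)"
        using that by (simp add: X[of _ l] sum_distrib_left mult_ac)
      also have "\<dots> = (\<Sum>j<d. x j * a l j)"
        by (subst sum.swap) (simp add: sum_distrib_right x_def)
      finally show ?thesis by simp
    qed
    show "\<exists>x. (\<Sum>j<d. x j * a k j) = t k \<and> (\<Sum>l\<in>K. v l * (\<Sum>j<d. x j * a l j)\<^sup>2) = t k"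
    proof (intro exI[of _ x] conjI)
      show "(\<Sum>j<d. x j * a k j) = t k"
        using *[OF k] by (simp add: t_def power2_eq_square)
      have "(\<Sum>l\<in>K. v l * (\<Sum>j<d. x j * a l j)\<^sup>2) = (\<Sum>l\<in>K. v l * (\<Sum>i<m. u i k * u i l)\<^sup>2)"
        using * by (intro sum.cong) auto
      then show "(\<Sum>l\<in>K. v l * (\<Sum>j<d. x j * a l j)\<^sup>2) = t k"
        using parseval[of "\<lambda>i. u i k"] by (simp add: t_def)
    qed
  qed
  have "(\<Sum>k\<in>K. v k * t k) = (\<Sum>i<m. \<Sum>k\<in>K. v k * u i k * u i k)"
    unfolding t_def by (subst sum.swap) (simp add: sum_distrib_left power2_eq_square mult_ac)
  also have "\<dots> = real m" by (simp add: orth)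
  finally have tr: "(\<Sum>k\<in>K. v k * t k) \<le> real d" using m by simp
  show ?thesis
    using m R lev tr unfolding t_def
    by (intro exI[of _ m] exI[of _ "\<lambda>k i. u i k"]) simp
qed

lemma is_leverageD:
  assumes "is_leverage d K a v t" and "k \<in> K"
  shows "(\<Sum>j<d. x j * a k j)\<^sup>2 \<le> t k * (\<Sum>l\<in>K. v l * (\<Sum>j<d. x j * a l j)\<^sup>2)"
  using assms unfolding is_leverage_def by blast

lemma is_leverage_nonneg:
  assumes "is_leverage d K a v t" and "\<And>k. k \<in> K \<Longrightarrow> v k > 0" and "k \<in> K"
  shows "t k \<ge> 0"
proof -
  obtain x where "(\<Sum>l\<in>K. v l * (\<Sum>j<d. x j * a l j)\<^sup>2) = t k"
    using assms(1,3) unfolding is_leverage_def by blast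
  moreover have "(\<Sum>l\<in>K. v l * (\<Sum>j<d. x j * a l j)\<^sup>2) \<ge> 0"
    using assms(2) by (intro sum_nonneg) (simp add: less_imp_le)
  ultimately show ?thesis by simp
qed

text \<open>The leverage inequality is tested on the \<open>j\<close>-th unit vector. Positivity
  keeps the weights \<open>t powr - s\<close> positive under iteration, since
  \<open>0 powr - s\<close> is 0.\<close>

lemma is_leverage_pos:
  assumes lev: "is_leverage d K a v t" and v: "\<And>k. k \<in> K \<Longrightarrow> v k > 0" and k: "k \<in> K"
    and "j < d" and nz: "a k j \<noteq> 0"
  shows "t k > 0"
proof -
  define x where "x = (\<lambda>i. if i = j then 1 else 0 :: real)"
  have "(\<Sum>i<d. x i * a k i) = (\<Sum>i<d. if i = j then a k j else 0)"
    by (intro sum.cong) (auto simp: x_def)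
  then have "(\<Sum>i<d. x i * a k i) = a k j"
    using \<open>j < d\<close> by simp
  then have "(a k j)\<^sup>2 \<le> t k * (\<Sum>l\<in>K. v l * (\<Sum>j<d. x j * a l j)\<^sup>2)"
    using is_leverageD[OF lev k, of x] by simp
  moreover have "(a k j)\<^sup>2 > 0" using nz by simp
  ultimately have "t k \<noteq> 0" by auto
  with is_leverage_nonneg[OF lev v k] show ?thesis by simp
qed

text \<open>Larger weights mean smaller leverage: the vector attaining \<open>t' k\<close> is
  inserted into the inequality for \<open>t\<close>, and one factor \<open>t' k\<close> cancels.
  Applied with \<open>c = 1\<close> in both directions, this shows that positive leverages are
  determined by the weights.\<close>

lemma is_leverage_antimono:
  assumes lev: "is_leverage d K a v t" and lev': "is_leverage d K a v' t'"
    and v: "\<And>k. k \<in> K \<Longrightarrow> v k > 0" and k: "k \<in> K" and "c \<ge> 0"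
    and le: "\<And>k. k \<in> K \<Longrightarrow> v k \<le> c * v' k" and "t' k > 0"
  shows "t' k \<le> c * t k"
proof -
  obtain x where x: "(\<Sum>j<d. x j * a k j) = t' k" "(\<Sum>l\<in>K. v' l * (\<Sum>j<d. x j * a l j)\<^sup>2) = t' k"
    using lev' k unfolding is_leverage_def by blast
  have "(\<Sum>l\<in>K. v l * (\<Sum>j<d. x j * a l j)\<^sup>2) \<le> (\<Sum>l\<in>K. c * (v' l * (\<Sum>j<d. x j * a l j)\<^sup>2))"
    by (intro sum_mono) (simp only: mult.assoc[symmetric], intro mult_right_mono le, auto)
  also have "\<dots> = c * t' k" by (simp add: x(2) flip: sum_distrib_left)
  finally have bound: "(\<Sum>l\<in>K. v l * (\<Sum>j<d. x j * a l j)\<^sup>2) \<le> c * t' k" .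
  have "(t' k)\<^sup>2 \<le> t k * (\<Sum>l\<in>K. v l * (\<Sum>j<d. x j * a l j)\<^sup>2)"
    using is_leverageD[OF lev k, of x] by (simp add: x(1))
  also have "\<dots> \<le> t k * (c * t' k)"
    using is_leverage_nonneg[OF lev v k] bound by (rule mult_left_mono[rotated])
  finally have "t' k * t' k \<le> (c * t k) * t' k" by (simp add: power2_eq_square mult_ac)
  then show ?thesis using \<open>t' k > 0\<close> by simp
qed

lemma powr_neg_le:
  fixes x y C s :: real
  assumes "0 < x" "0 < C" "x \<le> C * y" "s \<ge> 0"
  shows "y powr - s \<le> C powr s * x powr - s"
proof -
  have "y powr - s \<le> (x / C) powr - s"
    using assms by (intro powr_mono2') (auto simp: field_simps)
  also have "\<dots> = C powr s * x powr - s"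
    using assms by (simp add: powr_divide powr_minus field_simps)
  finally show ?thesis .
qed

text \<open>The map \<open>v \<mapsto> t powr - s\<close>, with \<open>t\<close> the leverage of \<open>v\<close>, contracts log-ratios
  by the factor \<open>s \<le> 1/2\<close>, so its iterates become approximate fixed points.\<close>

lemma approx_lewis_weights:
  fixes a :: "'k \<Rightarrow> nat \<Rightarrow> real"
  assumes K: "finite K" and nz: "\<And>k. k \<in> K \<Longrightarrow> \<exists>j<d. a k j \<noteq> 0"
    and s: "0 \<le> s" "s \<le> 1/2"
  shows "\<exists>v. (\<forall>k\<in>K. v k > 0) \<and> (\<forall>t. is_leverage d K a v t \<longrightarrow>
    (\<forall>k\<in>K. t k > 0 \<and> v k \<le> 2 * t k powr - s \<and> t k powr - s \<le> 2 * v k))"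
proof -
  have "\<exists>t. (\<forall>k\<in>K. v k > 0) \<longrightarrow> is_leverage d K a v t" for v
    using leverage_basis[OF K, of v d a] by blast
  then obtain T where T: "\<And>v. (\<And>k. k \<in> K \<Longrightarrow> v k > 0) \<Longrightarrow> is_leverage d K a v (T v)"
    by metis
  have T_pos: "T v k > 0" if "\<And>k. k \<in> K \<Longrightarrow> v k > 0" "k \<in> K" for v k
    using is_leverage_pos[OF T[of v] that] nz[OF that(2)] that(1) by blast
  define V where "V n = ((\<lambda>v k. T v k powr - s) ^^ n) (\<lambda>_. 1)" for n
  have V_Suc: "V (Suc n) k = T (V n) k powr - s" for n k
    by (simp add: V_def)
  have V_pos: "V n k > 0" if "k \<in> K" for n k
    using that
  proof (induction n arbitrary: k)
    case 0
    then show ?case by (simp add: V_def)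
  next
    case (Suc n)
    then show ?case using T_pos[of "V n" k] by (simp add: V_Suc)
  qed
  \<comment> \<open>A bound for the ratios of the first two iterates in both directions; the summand
    1 ensures \<open>c \<ge> 1\<close> even for empty \<open>K\<close>.\<close>
  define c where "c = 1 + (\<Sum>k\<in>K. V 1 k / V 0 k + V 0 k / V 1 k)"
  have ratio_pos: "V 1 k / V 0 k > 0" "V 0 k / V 1 k > 0" if "k \<in> K" for k
    using V_pos[OF that] by auto
  have c1: "c \<ge> 1" unfolding c_def using ratio_pos
    by (simp add: sum_nonneg add_nonneg_nonneg less_imp_le)
  have c_ge: "V 1 k / V 0 k \<le> c" "V 0 k / V 1 k \<le> c" if "k \<in> K" for k
  proof -
    have "V 1 k / V 0 k + V 0 k / V 1 k \<le> (\<Sum>k\<in>K. V 1 k / V 0 k + V 0 k / V 1 k)"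
      using that K ratio_pos by (intro member_le_sum) (auto intro!: add_nonneg_nonneg simp: less_imp_le)
    then show "V 1 k / V 0 k \<le> c" "V 0 k / V 1 k \<le> c"
      using ratio_pos[OF that] by (auto simp: c_def)
  qed
  have close: "\<forall>k\<in>K. V (Suc n) k \<le> c powr (s ^ n) * V n k \<and> V n k \<le> c powr (s ^ n) * V (Suc n) k" for n
  proof (induction n)
    case 0
    have "V 1 k \<le> c * V 0 k \<and> V 0 k \<le> c * V 1 k" if "k \<in> K" for k
      using c_ge[OF that] V_pos[OF that, of 0] V_pos[OF that, of 1] by (simp add: divide_le_eq)
    then show ?case using c1 by simp
  next
    case (Suc n)
    have C: "c powr (s ^ n) > 0" using c1 by simp
    have e: "(c powr (s ^ n)) powr s = c powr (s ^ Suc n)"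
      by (simp add: powr_powr mult.commute)
    show ?case
    proof
      fix k assume k: "k \<in> K"
      have L: "is_leverage d K a (V i) (T (V i))" for i
        using V_pos by (intro T) auto
      have P: "T (V i) k > 0" for i using T_pos[of "V i" k] V_pos k by blast
      \<comment> \<open>Comparable weights have comparable leverages with the same factor; raising
        to the power \<open>- s\<close> then turns \<open>c powr (s ^ n)\<close> into
        \<open>c powr (s ^ Suc n)\<close>.\<close>
      have *: "T (V n) k \<le> c powr (s ^ n) * T (V (Suc n)) k"
        using Suc.IH V_pos C by (intro is_leverage_antimono[OF L L _ k _ _ P]) (auto simp: less_imp_le)
      have **: "T (V (Suc n)) k \<le> c powr (s ^ n) * T (V n) k"
        using Suc.IH V_pos C by (intro is_leverage_antimono[OF L L _ k _ _ P]) (auto simp: less_imp_le)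
      show "V (Suc (Suc n)) k \<le> c powr (s ^ Suc n) * V (Suc n) k \<and>
          V (Suc n) k \<le> c powr (s ^ Suc n) * V (Suc (Suc n)) k"
        using powr_neg_le[OF P C * s(1)] powr_neg_le[OF P C ** s(1)] unfolding e V_Suc by blast
    qed
  qed
  have "(\<lambda>n. c powr (s ^ n)) \<longlonglongrightarrow> c powr 0"
    using s c1 by (intro tendsto_intros LIMSEQ_realpow_zero) auto
  then have "eventually (\<lambda>n. c powr (s ^ n) < 2) sequentially"
    using c1 by (intro order_tendstoD) auto
  then obtain n where n: "c powr (s ^ n) < 2"
    by (auto simp: eventually_sequentially)
  show ?thesis
  proof (intro exI[of _ "V n"] conjI ballI allI impI)
    fix t k assume t: "is_leverage d K a (V n) t" and k: "k \<in> K"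
    have L: "is_leverage d K a (V n) (T (V n))" using V_pos by (intro T) auto
    show t_pos: "t k > 0"
      using is_leverage_pos[OF t V_pos k] nz[OF k] by blast
    \<comment> \<open>Leverages of the same weights agree on \<open>K\<close>, so what is known for
      the chosen \<open>T (V n)\<close> passes to an arbitrary \<open>t\<close>.\<close>
    have "t k \<le> 1 * T (V n) k"
      using V_pos t_pos by (intro is_leverage_antimono[OF L t _ k]) auto
    moreover have "T (V n) k \<le> 1 * t k"
      using V_pos T_pos[of "V n" k] k by (intro is_leverage_antimono[OF t L _ k]) auto
    ultimately have "t k powr - s = V (Suc n) k" by (simp add: V_Suc)
    moreover have "c powr (s ^ n) * V i k \<le> 2 * V i k" for i
      using n V_pos[OF k, of i] by (intro mult_right_mono) auto
    ultimately show "V n k \<le> 2 * t k powr - s" "t k powr - s \<le> 2 * V n k"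
      using close[of n] k by (metis order_trans)+
  qed (use V_pos in auto)
qed

text \<open>With \<open>s = 1 - p / 2\<close>, weights comparable to \<open>t powr - s\<close> give
  both estimates. For the rows, \<open>t powr (p / 2) = t powr - s * t \<le> 2 * v * t\<close>, and
  the products \<open>v * t\<close> sum to at most \<open>d\<close>. For a vector with entries
  \<open>f k\<close> and \<open>Y\<close> the squared Euclidean norm of \<open>y\<close>, the
  leverage inequality bounds |f k|^(2-p) by \<open>(t k * Y) powr s\<close>; the powers of
  \<open>t k\<close> cancel in \<open>v k * (f k)\<^sup>2\<close>, and summation bounds
  \<open>Y\<close> by \<open>Y powr s\<close> times twice the p-th power sum.\<close>

lemma lewis_basis:
  fixes a :: "nat \<Rightarrow> nat \<Rightarrow> real" and p :: real
  assumes p: "1 \<le> p" "p < 2"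
  shows "\<exists>m b. m \<le> d
    \<and> (\<forall>x. \<exists>y. (\<forall>k<n. (\<Sum>j<d. x j * a k j) = (\<Sum>i<m. y i * b k i))
        \<and> (\<Sum>i<m. (y i)\<^sup>2) powr (p / 2) \<le> 2 * (\<Sum>k<n. \<bar>\<Sum>j<d. x j * a k j\<bar> powr p))
    \<and> (\<Sum>k<n. (\<Sum>i<m. (b k i)\<^sup>2) powr (p / 2)) \<le> 2 * real d"
proof -
  \<comment> \<open>Zero rows have leverage 0, which has no usable negative power; they are set
    aside and return as zero rows of \<open>b'\<close>.\<close>
  define K where "K = {k\<in>{..<n}. \<exists>j<d. a k j \<noteq> 0}"
  define s where "s = 1 - p / 2"
  have K: "finite K" "K \<subseteq> {..<n}" by (auto simp: K_def)
  obtain v where v: "\<And>k. k \<in> K \<Longrightarrow> v k > 0" and vt: "\<And>t k. is_leverage d K a v t \<Longrightarrow> k \<in> K \<Longrightarrow>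
      t k > 0 \<and> v k \<le> 2 * t k powr - s \<and> t k powr - s \<le> 2 * v k"
    using approx_lewis_weights[OF K(1), of d a s] p unfolding K_def s_def by fastforce
  obtain m b where m: "m \<le> d"
    and repr: "\<And>x. \<exists>y. (\<forall>k\<in>K. (\<Sum>j<d. x j * a k j) = (\<Sum>i<m. y i * b k i))
          \<and> (\<Sum>i<m. (y i)\<^sup>2) = (\<Sum>k\<in>K. v k * (\<Sum>j<d. x j * a k j)\<^sup>2)"
    and lev: "is_leverage d K a v (\<lambda>k. \<Sum>i<m. (b k i)\<^sup>2)"
    and tr: "(\<Sum>k\<in>K. v k * (\<Sum>i<m. (b k i)\<^sup>2)) \<le> real d"
    using leverage_basis[OF K(1), of v d a] v by blast
  define t where "t k = (\<Sum>i<m. (b k i)\<^sup>2)" for k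
  note lev = lev[folded t_def] and tr = tr[folded t_def]
  note vt = vt[OF lev]
  define b' where "b' k i = (if k \<in> K then b k i else 0)" for k i
  have zero: "(\<Sum>j<d. x j * a k j) = 0" if "k < n" "k \<notin> K" for k x
    using that by (intro sum.neutral) (auto simp: K_def)
  have "(\<Sum>k<n. (\<Sum>i<m. (b' k i)\<^sup>2) powr (p / 2)) = (\<Sum>k\<in>K. t k powr (p / 2))"
    using K by (intro sum.mono_neutral_cong_right) (auto simp: b'_def t_def)
  also have "\<dots> \<le> (\<Sum>k\<in>K. 2 * (v k * t k))"
  proof (intro sum_mono)
    fix k assume k: "k \<in> K"
    have "t k powr (p / 2) = t k powr (- s + 1)" by (simp add: s_def)
    also have "\<dots> = t k powr - s * t k"
      using vt[OF k] by (subst powr_add) simp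
    also have "\<dots> \<le> 2 * v k * t k"
      using vt[OF k] by (intro mult_right_mono) auto
    finally show "t k powr (p / 2) \<le> 2 * (v k * t k)" by simp
  qed
  also have "\<dots> \<le> 2 * real d" using tr by (simp flip: sum_distrib_left)
  finally have rows: "(\<Sum>k<n. (\<Sum>i<m. (b' k i)\<^sup>2) powr (p / 2)) \<le> 2 * real d" .
  have "\<exists>y. (\<forall>k<n. (\<Sum>j<d. x j * a k j) = (\<Sum>i<m. y i * b' k i))
        \<and> (\<Sum>i<m. (y i)\<^sup>2) powr (p / 2) \<le> 2 * (\<Sum>k<n. \<bar>\<Sum>j<d. x j * a k j\<bar> powr p)" for x
  proof -
    define f where "f k = (\<Sum>j<d. x j * a k j)" for k
    obtain y where y: "\<And>k. k \<in> K \<Longrightarrow> f k = (\<Sum>i<m. y i * b k i)"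
      and y2: "(\<Sum>i<m. (y i)\<^sup>2) = (\<Sum>k\<in>K. v k * (f k)\<^sup>2)"
      using repr unfolding f_def by blast
    define Y where "Y = (\<Sum>i<m. (y i)\<^sup>2)"
    have Y0: "Y \<ge> 0" by (simp add: Y_def sum_nonneg)
    have "Y powr (p / 2) \<le> 2 * (\<Sum>k<n. \<bar>f k\<bar> powr p)"
    proof (cases "Y = 0")
      case True
      then show ?thesis by (simp add: sum_nonneg)
    next
      case False
      with Y0 have Ypos: "Y > 0" by simp
      have term_le: "v k * (f k)\<^sup>2 \<le> 2 * \<bar>f k\<bar> powr p * Y powr s" if k: "k \<in> K" for k
      proof -
        have "(f k)\<^sup>2 \<le> t k * Y"
          using is_leverageD[OF lev k, of x] unfolding Y_def y2 f_def .
        then have "((f k)\<^sup>2) powr s \<le> (t k * Y) powr s"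
          using p by (intro powr_mono2) (auto simp: s_def)
        then have le: "((f k)\<^sup>2) powr s \<le> t k powr s * Y powr s"
          using vt[OF k] Ypos by (simp add: powr_mult)
        have sq: "(f k)\<^sup>2 = \<bar>f k\<bar> powr p * ((f k)\<^sup>2) powr s"
        proof (cases "f k = 0")
          case False
          then have "\<bar>f k\<bar> powr p * ((f k)\<^sup>2) powr s = \<bar>f k\<bar> powr p * (\<bar>f k\<bar> powr 2) powr s"
            by simp
          also have "\<dots> = \<bar>f k\<bar> powr 2"
            unfolding powr_powr powr_add[symmetric] by (simp add: s_def)
          finally show ?thesis using False by simp
        qed simp
        have "v k * (f k)\<^sup>2 \<le> (2 * t k powr - s) * (\<bar>f k\<bar> powr p * (t k powr s * Y powr s))"
          using vt[OF k] v[OF k] le by (subst sq, intro mult_mono) (auto intro: mult_left_mono)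
        also have "\<dots> = 2 * \<bar>f k\<bar> powr p * Y powr s"
        proof -
          have "t k powr - s * t k powr s = 1"
            using vt[OF k] by (simp add: powr_minus)
          then show ?thesis by (simp add: mult_ac)
        qed
        finally show ?thesis .
      qed
      have "Y \<le> (\<Sum>k\<in>K. 2 * \<bar>f k\<bar> powr p * Y powr s)"
        unfolding Y_def[unfolded y2] y2 by (intro sum_mono term_le[unfolded Y_def y2])
      also have "\<dots> = 2 * (\<Sum>k\<in>K. \<bar>f k\<bar> powr p) * Y powr s"
        by (simp add: sum_distrib_left sum_distrib_right mult_ac)
      also have "(\<Sum>k\<in>K. \<bar>f k\<bar> powr p) \<le> (\<Sum>k<n. \<bar>f k\<bar> powr p)"
        using K by (intro sum_mono2) auto
      finally have "Y \<le> 2 * (\<Sum>k<n. \<bar>f k\<bar> powr p) * Y powr s"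
        by (simp add: mult_right_mono)
      \<comment> \<open>Since \<open>p / 2 + s = 1\<close>, the factor \<open>Y powr s\<close>
        divides out of the bound.\<close>
      moreover have "Y = Y powr (p / 2) * Y powr s"
        using Ypos by (simp add: s_def flip: powr_add)
      ultimately have "Y powr (p / 2) * Y powr s \<le> 2 * (\<Sum>k<n. \<bar>f k\<bar> powr p) * Y powr s"
        by simp
      then show ?thesis using Ypos by simp
    qed
    moreover have "f k = (\<Sum>i<m. y i * b' k i)" if "k < n" for k
      using that y zero by (cases "k \<in> K") (auto simp: b'_def f_def)
    ultimately show ?thesis unfolding f_def Y_def by blast
  qed
  with m rows show ?thesis by blast
qed

section \<open>A finite heavy-tailed distribution\<close>

definition stable_ints :: "nat \<Rightarrow> int set" where
  "stable_ints N = {- int N..int N} - {0}"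

text \<open>For a uniform sample from \<open>stable_ints N\<close> this is a symmetric discretisation of the Pareto
  law with tail index \<open>p\<close>, a finite substitute for a \<open>p\<close>-stable variable.\<close>

definition stable_val :: "real \<Rightarrow> nat \<Rightarrow> int \<Rightarrow> real" where
  "stable_val p N w = sgn (real_of_int w) * (real N / \<bar>real_of_int w\<bar>) powr (1 / p)"

lemma finite_stable_ints [simp]: "finite (stable_ints N)"
  by (simp add: stable_ints_def)

lemma stable_ints_nonempty: "N > 0 \<Longrightarrow> stable_ints N \<noteq> {}"
proof -
  assume "N > 0"
  then have "1 \<in> stable_ints N" by (simp add: stable_ints_def)
  then show ?thesis by blast
qed

lemma card_stable_ints: "card (stable_ints N) = 2 * N"
  by (simp add: stable_ints_def card_Diff_subset)

lemma uminus_stable_ints: "w \<in> stable_ints N \<Longrightarrow> - w \<in> stable_ints N"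
  by (auto simp: stable_ints_def)

lemma stable_val_uminus: "stable_val p N (- w) = - stable_val p N w"
  by (simp add: stable_val_def sgn_minus)

lemma abs_stable_val_powr:
  assumes "p > 0" and "w \<in> stable_ints N"
  shows "\<bar>stable_val p N w\<bar> powr p = real N / \<bar>real_of_int w\<bar>"
  using assms by (auto simp: stable_val_def stable_ints_def abs_mult powr_powr abs_sgn_eq)

lemma sum_stable_ints:
  fixes g :: "int \<Rightarrow> real"
  assumes "\<And>w. g (- w) = g w"
  shows "(\<Sum>w\<in>stable_ints N. g w) = 2 * (\<Sum>k=1..N. g (int k))"
proof -
  have split: "stable_ints N = int ` {1..N} \<union> (\<lambda>k. - int k) ` {1..N}"
  proof (intro Set.set_eqI iffI)
    fix w assume w: "w \<in> stable_ints N"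
    show "w \<in> int ` {1..N} \<union> (\<lambda>k. - int k) ` {1..N}"
    proof (cases "w > 0")
      case True
      then have "w = int (nat w)" "nat w \<in> {1..N}" using w by (auto simp: stable_ints_def)
      then show ?thesis by blast
    next
      case False
      then have "w = - int (nat (- w))" "nat (- w) \<in> {1..N}" using w by (auto simp: stable_ints_def)
      then show ?thesis by blast
    qed
  qed (auto simp: stable_ints_def)
  have "(\<Sum>w\<in>stable_ints N. g w)
      = (\<Sum>w\<in>int ` {1..N}. g w) + (\<Sum>w\<in>(\<lambda>k. - int k) ` {1..N}. g w)"
    unfolding split by (intro sum.union_disjoint) auto
  also have "\<dots> = (\<Sum>k=1..N. g (int k)) + (\<Sum>k=1..N. g (- int k))"
    by (subst (1 2) sum.reindex) (auto simp: inj_on_def)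
  finally show ?thesis by (simp add: assms)
qed

text \<open>As |X|^p = N / |w|, the tail event reads |w| \<le> N / s. It is a smaller set of the
  same kind, so tail probabilities are ratios of cardinalities.\<close>

lemma stable_ints_Int_le:
  assumes "p > 0" "N > 0" "s > 0"
  shows "stable_ints N \<inter> {w. s \<le> \<bar>stable_val p N w\<bar> powr p}
    = stable_ints (min N (nat \<lfloor>real N / s\<rfloor>))"
proof (intro Set.set_eqI iffI)
  fix w assume w: "w \<in> stable_ints N \<inter> {w. s \<le> \<bar>stable_val p N w\<bar> powr p}"
  then have "real_of_int \<bar>w\<bar> \<le> real N / s" and "w \<noteq> 0"
    using assms by (auto simp: abs_stable_val_powr field_simps stable_ints_def)
  then have "\<bar>w\<bar> \<le> \<lfloor>real N / s\<rfloor>" by linarith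
  then show "w \<in> stable_ints (min N (nat \<lfloor>real N / s\<rfloor>))"
    using w by (auto simp: stable_ints_def)
next
  fix w assume w: "w \<in> stable_ints (min N (nat \<lfloor>real N / s\<rfloor>))"
  then have "\<bar>w\<bar> \<le> \<lfloor>real N / s\<rfloor>" and wN: "w \<in> stable_ints N" and "w \<noteq> 0"
    by (auto simp: stable_ints_def)
  then have "real_of_int \<bar>w\<bar> \<le> real N / s" by linarith
  then have "s \<le> real N / \<bar>real_of_int w\<bar>" using assms \<open>w \<noteq> 0\<close> by (simp add: field_simps)
  then show "w \<in> stable_ints N \<inter> {w. s \<le> \<bar>stable_val p N w\<bar> powr p}"
    using wN abs_stable_val_powr[OF assms(1) wN] by simp
qed

lemma prob_stable_val_ge:
  assumes "p > 0" "N > 0" "s > 0"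
  shows "measure_pmf.prob (pmf_of_set (stable_ints N)) {w. s \<le> \<bar>stable_val p N w\<bar> powr p}
    = min 1 (real (nat \<lfloor>real N / s\<rfloor>) / real N)"
proof -
  have "measure_pmf.prob (pmf_of_set (stable_ints N)) {w. s \<le> \<bar>stable_val p N w\<bar> powr p}
      = real (2 * min N (nat \<lfloor>real N / s\<rfloor>)) / real (2 * N)"
    using assms by (subst measure_pmf_of_set)
      (simp_all only: stable_ints_nonempty[OF assms(2)] finite_stable_ints
        stable_ints_Int_le[OF assms] card_stable_ints not_False_eq_True)
  also have "\<dots> = real (min N (nat \<lfloor>real N / s\<rfloor>)) / real N" by simp
  also have "\<dots> = min 1 (real (nat \<lfloor>real N / s\<rfloor>) / real N)"
    using assms by (auto simp: min_def field_simps)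
  finally show ?thesis .
qed

lemma prob_stable_val_ge_upper:
  assumes "p > 0" "N > 0" "s > 0"
  shows "measure_pmf.prob (pmf_of_set (stable_ints N)) {w. s \<le> \<bar>stable_val p N w\<bar> powr p} \<le> 1 / s"
proof -
  have "real (nat \<lfloor>real N / s\<rfloor>) / real N \<le> (real N / s) / real N"
    using assms by (intro divide_right_mono) (auto simp: of_nat_floor)
  also have "\<dots> = 1 / s" using assms by simp
  finally show ?thesis unfolding prob_stable_val_ge[OF assms] by simp
qed

text \<open>The loss \<open>1 / real N\<close> is the price of rounding down. Summed over
  \<open>n\<close> coordinates it is n / N, which is 1/2 for the later choice
  \<open>N = 2 * n\<close>.\<close>

lemma prob_stable_val_ge_lower:
  assumes "p > 0" "N > 0" "s \<ge> 1"
  shows "measure_pmf.prob (pmf_of_set (stable_ints N)) {w. s \<le> \<bar>stable_val p N w\<bar> powr p}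
    \<ge> 1 / s - 1 / real N"
proof -
  have "1 / s - 1 / real N = (real N / s - 1) / real N"
    using assms by (simp add: field_simps)
  also have "\<dots> \<le> real (nat \<lfloor>real N / s\<rfloor>) / real N"
    using assms by (intro divide_right_mono) linarith+
  finally have "1 / s - 1 / real N \<le> real (nat \<lfloor>real N / s\<rfloor>) / real N" .
  moreover have "1 / s - 1 / real N \<le> 1"
    using assms by (simp add: field_simps add_increasing)
  ultimately show ?thesis
    using assms by (subst prob_stable_val_ge) auto
qed

text \<open>Mean value theorem for x^(1-a) between \<open>k\<close> and \<open>Suc k\<close>. The
  intermediate point lies below \<open>Suc k\<close>, hence below \<open>2 * k\<close>, which costs
  the factor \<open>2 powr a\<close>.\<close>

lemma powr_minus_le_telescope:
  fixes a :: real
  assumes a: "a > 1" and "k \<ge> 1"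
  shows "real k powr - a
    \<le> 2 powr a / (a - 1) * (real k powr (1 - a) - real (Suc k) powr (1 - a))"
proof -
  have "\<exists>z. z > real k \<and> z < real (Suc k) \<and>
      real (Suc k) powr (1 - a) - real k powr (1 - a)
        = (real (Suc k) - real k) * ((1 - a) * z powr (1 - a - 1))"
    using assms by (intro MVT2) (auto intro!: derivative_eq_intros)
  then obtain z where z: "z > real k" "z < real (Suc k)"
    and eq: "real (Suc k) powr (1 - a) - real k powr (1 - a) = (1 - a) * z powr - a"
    by auto
  have "(2 * real k) powr - a \<le> z powr - a"
    using z assms by (intro powr_mono2') auto
  then have "real k powr - a \<le> 2 powr a * z powr - a"
    using assms by (simp add: powr_mult powr_minus field_simps)
  also have "\<dots> = 2 powr a / (a - 1) * ((a - 1) * z powr - a)"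
    using a by simp
  also have "(a - 1) * z powr - a = real k powr (1 - a) - real (Suc k) powr (1 - a)"
    using eq by (simp add: algebra_simps)
  finally show ?thesis .
qed

lemma sum_powr_minus_le:
  fixes a :: real
  assumes a: "a > 1" and "m \<ge> 1"
  shows "(\<Sum>k=m..N. real k powr - a) \<le> 2 powr a / (a - 1) * real m powr (1 - a)"
proof (cases "m \<le> N")
  case True
  have "(\<Sum>k=m..N. real k powr - a)
      \<le> (\<Sum>k=m..N. 2 powr a / (a - 1) * (real k powr (1 - a) - real (Suc k) powr (1 - a)))"
    using assms by (intro sum_mono powr_minus_le_telescope) auto
  also have "\<dots> = 2 powr a / (a - 1) * (\<Sum>k=m..N. real k powr (1 - a) - real (Suc k) powr (1 - a))"
    by (rule sum_distrib_left[symmetric])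
  also have "(\<Sum>k=m..N. real k powr (1 - a) - real (Suc k) powr (1 - a))
      = real m powr (1 - a) - real (Suc N) powr (1 - a)"
    using sum_Suc_diff[of m "Suc N" "\<lambda>k. - (real k powr (1 - a))"] True
    by simp
  also have "2 powr a / (a - 1) * (real m powr (1 - a) - real (Suc N) powr (1 - a))
      \<le> 2 powr a / (a - 1) * real m powr (1 - a)"
    using a by (intro mult_left_mono) auto
  finally show ?thesis .
qed (use a in auto)

text \<open>The truncation keeps |w| \<ge> N / s, where X^2 = (N / |w|)^(2/p). Because 2/p > 1, the
  sum of |w|^(-2/p) over this range is of order (N / s)^(1-2/p). All powers of \<open>N\<close> then
  cancel against the normalisation, and the constant blows up only as p approaches 2.\<close>

lemma stable_val_truncated_second_moment:
  assumes p: "0 < p" "p < 2" and N: "N > 0" and s: "s > 0"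
  shows "measure_pmf.expectation (pmf_of_set (stable_ints N))
      (\<lambda>w. if \<bar>stable_val p N w\<bar> powr p \<le> s then (stable_val p N w)\<^sup>2 else 0)
    \<le> 2 powr (2 / p) / (2 / p - 1) * s powr (2 / p - 1)"
proof -
  define a where "a = 2 / p"
  have a: "a > 1" using p by (simp add: a_def)
  define g where "g w = (if \<bar>stable_val p N w\<bar> powr p \<le> s then (stable_val p N w)\<^sup>2 else 0)" for w
  define m where "m = max 1 (nat \<lceil>real N / s\<rceil>)"
  have "real N / s \<le> real (nat \<lceil>real N / s\<rceil>)" by (rule real_nat_ceiling_ge)
  also have "\<dots> \<le> real m" unfolding m_def by simp
  finally have m: "m \<ge> 1" "real m \<ge> real N / s" by (simp_all add: m_def)
  have g_le: "g (int k) \<le> (if k \<in> {m..N} then real N powr a * real k powr - a else 0)"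
    if k: "k \<in> {1..N}" for k
  proof -
    have kI: "int k \<in> stable_ints N" using k by (simp add: stable_ints_def)
    have abs: "\<bar>stable_val p N (int k)\<bar> powr p = real N / real k"
      using abs_stable_val_powr[OF p(1) kI] by simp
    show ?thesis
    proof (cases "real N / real k \<le> s")
      case True
      then have "real N / s \<le> real k" using k s by (simp add: field_simps)
      then have "m \<le> k" using k unfolding m_def by simp
      moreover have "(stable_val p N (int k))\<^sup>2 = real N powr a * real k powr - a"
      proof -
        have "(stable_val p N (int k))\<^sup>2 = ((real N / real k) powr (1 / p)) powr 2"
          using k N by (simp add: stable_val_def)
        also have "\<dots> = (real N / real k) powr a"
          by (simp add: powr_powr a_def)
        finally show ?thesis using k by (simp add: powr_divide powr_minus field_simps)
      qed
      ultimately show ?thesis using True k by (simp add: g_def abs)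
    qed (simp add: g_def abs)
  qed
  have "(\<Sum>w\<in>stable_ints N. g w) = 2 * (\<Sum>k=1..N. g (int k))"
    by (intro sum_stable_ints) (simp add: g_def stable_val_uminus)
  also have "(\<Sum>k=1..N. g (int k))
      \<le> (\<Sum>k=1..N. if k \<in> {m..N} then real N powr a * real k powr - a else 0)"
    by (intro sum_mono g_le)
  also have "\<dots> = (\<Sum>k=m..N. real N powr a * real k powr - a)"
    using m(1) by (intro sum.mono_neutral_cong_right) auto
  also have "\<dots> = real N powr a * (\<Sum>k=m..N. real k powr - a)"
    by (rule sum_distrib_left[symmetric])
  also have "\<dots> \<le> real N powr a * (2 powr a / (a - 1) * real m powr (1 - a))"
    using a m(1) by (intro mult_left_mono sum_powr_minus_le) auto
  also have "\<dots> \<le> real N powr a * (2 powr a / (a - 1) * (real N / s) powr (1 - a))"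
    using a m N s by (intro mult_left_mono powr_mono2') auto
  also have "\<dots> = real N * (2 powr a / (a - 1) * s powr (a - 1))"
  proof -
    have "real N powr a * (real N / s) powr (1 - a) = (real N powr a * real N powr (1 - a)) * s powr (a - 1)"
      using N s by (simp add: powr_divide powr_minus_divide[of s "1 - a"] field_simps powr_diff)
    also have "real N powr a * real N powr (1 - a) = real N"
      using N by (simp flip: powr_add)
    finally show ?thesis by (simp add: mult_ac)
  qed
  finally have "(\<Sum>w\<in>stable_ints N. g w) \<le> 2 * (real N * (2 powr a / (a - 1) * s powr (a - 1)))"
    by simp
  then have "(\<Sum>w\<in>stable_ints N. g w) / real (2 * N) \<le> 2 powr a / (a - 1) * s powr (a - 1)"
    using N by (simp add: field_simps)
  then show ?thesis
    using N unfolding g_def a_def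
    by (subst integral_pmf_of_set) (simp_all add: stable_ints_nonempty card_stable_ints)
qed

section \<open>Random rows: sign flips, anticoncentration and norm tails\<close>

definition stable_row_pmf :: "nat \<Rightarrow> nat \<Rightarrow> (nat \<Rightarrow> int) pmf" where
  "stable_row_pmf n N = Pi_pmf {..<n} 0 (\<lambda>_. pmf_of_set (stable_ints N))"

lemma stable_row_pmf_eq:
  assumes "N > 0"
  shows "stable_row_pmf n N = pmf_of_set (PiE_dflt {..<n} 0 (\<lambda>_. stable_ints N))"
  unfolding stable_row_pmf_def using assms by (intro Pi_pmf_of_set) (auto simp: stable_ints_nonempty)

lemma finite_set_stable_row_pmf:
  assumes "N > 0"
  shows "finite (set_pmf (stable_row_pmf n N))"
proof -
  have "finite (PiE_dflt {..<n} 0 (\<lambda>_. stable_ints N))" by auto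
  then show ?thesis
    using assms by (simp add: stable_row_pmf_eq stable_ints_nonempty)
qed

lemma integrable_stable_row_pmf [simp]:
  fixes f :: "_ \<Rightarrow> real"
  shows "N > 0 \<Longrightarrow> integrable (measure_pmf (stable_row_pmf n N)) f"
  by (intro integrable_measure_pmf_finite finite_set_stable_row_pmf)

lemma stable_row_pmf_component:
  "k < n \<Longrightarrow> map_pmf (\<lambda>\<omega>. \<omega> k) (stable_row_pmf n N) = pmf_of_set (stable_ints N)"
  unfolding stable_row_pmf_def by (subst Pi_pmf_component) auto

definition flip_sign :: "nat \<Rightarrow> (nat \<Rightarrow> int) \<Rightarrow> nat \<Rightarrow> int" where
  "flip_sign k \<omega> = (\<lambda>j. if j = k then - \<omega> j else \<omega> j)"

lemma map_flip_stable_row_pmf: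
  assumes N: "N > 0" and k: "k < n"
  shows "map_pmf (flip_sign k) (stable_row_pmf n N) = stable_row_pmf n N"
proof -
  let ?\<Omega> = "PiE_dflt {..<n} 0 (\<lambda>_. stable_ints N)"
  have "(flip_sign k) ` ?\<Omega> \<subseteq> ?\<Omega>"
    using k by (auto simp: PiE_dflt_def flip_sign_def uminus_stable_ints)
  then have "bij_betw (flip_sign k) ?\<Omega> ?\<Omega>"
    by (intro bij_betw_byWitness[where f' = "flip_sign k"]) (auto simp: flip_sign_def)
  then show ?thesis
    unfolding stable_row_pmf_eq[OF N] using N
    by (intro map_pmf_of_set_bij_betw) (auto simp: stable_ints_nonempty)
qed

lemma prob_flip_sign_vimage:
  assumes "N > 0" and "k < n"
  shows "measure_pmf.prob (stable_row_pmf n N) (flip_sign k -` A) = measure_pmf.prob (stable_row_pmf n N) A"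
proof -
  have "measure_pmf.prob (map_pmf (flip_sign k) (stable_row_pmf n N)) A
      = measure_pmf.prob (stable_row_pmf n N) (flip_sign k -` A)"
    by (rule measure_map_pmf)
  then show ?thesis by (simp add: map_flip_stable_row_pmf[OF assms])
qed

lemma expectation_flip_sign:
  assumes "N > 0" and "k < n"
  shows "measure_pmf.expectation (stable_row_pmf n N) (\<lambda>\<omega>. f (flip_sign k \<omega>))
    = measure_pmf.expectation (stable_row_pmf n N) (f :: _ \<Rightarrow> real)"
  using integral_map_pmf[of "flip_sign k" "stable_row_pmf n N" f]
  by (simp add: map_flip_stable_row_pmf[OF assms])

lemma prob_stable_row_component:
  assumes "k < n"
  shows "measure_pmf.prob (stable_row_pmf n N) {\<omega>. P (\<omega> k)}
    = measure_pmf.prob (pmf_of_set (stable_ints N)) {w. P w}"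
proof -
  have "measure_pmf.prob (map_pmf (\<lambda>\<omega>. \<omega> k) (stable_row_pmf n N)) {w. P w}
      = measure_pmf.prob (stable_row_pmf n N) {\<omega>. P (\<omega> k)}"
    by (subst measure_map_pmf) (simp add: vimage_def)
  then show ?thesis by (simp add: stable_row_pmf_component[OF assms])
qed

lemma expectation_stable_row_component:
  assumes "k < n"
  shows "measure_pmf.expectation (stable_row_pmf n N) (\<lambda>\<omega>. g (\<omega> k))
    = measure_pmf.expectation (pmf_of_set (stable_ints N)) (g :: _ \<Rightarrow> real)"
  using integral_map_pmf[of "\<lambda>\<omega>. \<omega> k" "stable_row_pmf n N" g]
  by (simp add: stable_row_pmf_component[OF assms])

definition stable_form :: "real \<Rightarrow> nat \<Rightarrow> nat \<Rightarrow> (nat \<Rightarrow> real) \<Rightarrow> (nat \<Rightarrow> int) \<Rightarrow> real" where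
  "stable_form p N n z \<omega> = (\<Sum>k<n. stable_val p N (\<omega> k) * z k)"

text \<open>Levy's argument: flipping the sign of the first summand that is large makes the whole sum
  large in at least one of the two cases.\<close>

lemma levy_inequality:
  fixes z :: "nat \<Rightarrow> real"
  assumes N: "N > 0" and p: "p > 0"
  shows "measure_pmf.prob (stable_row_pmf n N) {\<omega>. \<exists>k<n. h \<le> \<bar>stable_val p N (\<omega> k) * z k\<bar> powr p}
    \<le> 2 * measure_pmf.prob (stable_row_pmf n N) {\<omega>. h \<le> \<bar>stable_form p N n z \<omega>\<bar> powr p}"
proof -
  let ?P = "measure_pmf.prob (stable_row_pmf n N)"
  define big where "big k \<omega> \<longleftrightarrow> h \<le> \<bar>stable_val p N (\<omega> k) * z k\<bar> powr p" for k and \<omega> :: "nat \<Rightarrow> int"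
  \<comment> \<open>Splitting by the first large index makes the events disjoint, so the factor 2 is
    paid once in total and not once per large coordinate.\<close>
  define M where "M k = {\<omega>. big k \<omega> \<and> (\<forall>j<k. \<not> big j \<omega>)}" for k
  define G where "G = {\<omega>. h \<le> \<bar>stable_form p N n z \<omega>\<bar> powr p}"
  have big_flip: "big j (flip_sign k \<omega>) = big j \<omega>" for j k \<omega>
    by (simp add: big_def flip_sign_def stable_val_uminus)
  have disj: "disjoint_family_on M {..<n}"
  proof -
    have "M i \<inter> M j = {}" if "i < j" for i j
      using that by (auto simp: M_def)
    then show ?thesis
      unfolding disjoint_family_on_def by (metis Int_commute linorder_neqE_nat)
  qed
  have U: "{\<omega>. \<exists>k<n. big k \<omega>} = (\<Union>k<n. M k)"
  proof (intro Set.set_eqI iffI)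
    fix \<omega> assume "\<omega> \<in> {\<omega>. \<exists>k<n. big k \<omega>}"
    then obtain k where k: "k < n" "big k \<omega>" by blast
    define l where "l = (LEAST k. big k \<omega>)"
    have "big l \<omega>" "l \<le> k" "\<forall>j<l. \<not> big j \<omega>"
      unfolding l_def using k(2) by (auto intro: LeastI Least_le dest: not_less_Least)
    then show "\<omega> \<in> (\<Union>k<n. M k)" using k(1) by (auto simp: M_def)
  qed (auto simp: M_def)
  have step: "?P (M k) \<le> 2 * ?P (M k \<inter> G)" if k: "k < n" for k
  proof -
    \<comment> \<open>\<open>big\<close> sees only absolute values, so the flip at \<open>k\<close>
      maps \<open>M k\<close> to itself. It turns the sum x + y into y - x, and these two cannot
      both be smaller than x in absolute value.\<close>
    have "M k \<subseteq> (M k \<inter> G) \<union> flip_sign k -` (M k \<inter> G)"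
    proof
      fix \<omega> assume \<omega>: "\<omega> \<in> M k"
      then have flip_M: "flip_sign k \<omega> \<in> M k" by (simp add: M_def big_flip)
      define x where "x = stable_val p N (\<omega> k) * z k"
      define y where "y = (\<Sum>j\<in>{..<n} - {k}. stable_val p N (\<omega> j) * z j)"
      have split: "(\<Sum>j<n. f j) = f k + (\<Sum>j\<in>{..<n} - {k}. f j)" for f :: "nat \<Rightarrow> real"
        using k by (intro sum.remove) auto
      have 1: "stable_form p N n z \<omega> = x + y"
        unfolding stable_form_def split x_def y_def ..
      have "stable_form p N n z (flip_sign k \<omega>)
          = - x + (\<Sum>j\<in>{..<n} - {k}. stable_val p N (flip_sign k \<omega> j) * z j)"
        unfolding stable_form_def split by (simp add: x_def flip_sign_def stable_val_uminus)
      also have "(\<Sum>j\<in>{..<n} - {k}. stable_val p N (flip_sign k \<omega> j) * z j) = y"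
        unfolding y_def by (intro sum.cong) (auto simp: flip_sign_def)
      finally have 2: "stable_form p N n z (flip_sign k \<omega>) = - x + y" .
      have hx: "h \<le> \<bar>x\<bar> powr p" using \<omega> by (simp add: M_def big_def x_def)
      consider "\<bar>x\<bar> \<le> \<bar>x + y\<bar>" | "\<bar>x\<bar> \<le> \<bar>- x + y\<bar>" by linarith
      then have "\<omega> \<in> G \<or> flip_sign k \<omega> \<in> G"
      proof cases
        case 1
        then have "\<bar>x\<bar> powr p \<le> \<bar>x + y\<bar> powr p" using p by (intro powr_mono2) auto
        then show ?thesis using hx \<open>stable_form p N n z \<omega> = x + y\<close> by (simp add: G_def)
      next
        case 2
        then have "\<bar>x\<bar> powr p \<le> \<bar>- x + y\<bar> powr p" using p by (intro powr_mono2) auto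
        then show ?thesis using hx \<open>stable_form p N n z (flip_sign k \<omega>) = - x + y\<close> by (simp add: G_def)
      qed
      then show "\<omega> \<in> (M k \<inter> G) \<union> flip_sign k -` (M k \<inter> G)"
        using \<omega> flip_M by auto
    qed
    then have "?P (M k) \<le> ?P ((M k \<inter> G) \<union> flip_sign k -` (M k \<inter> G))"
      by (intro measure_pmf.finite_measure_mono) auto
    also have "\<dots> \<le> ?P (M k \<inter> G) + ?P (flip_sign k -` (M k \<inter> G))"
      by (intro measure_Un_le) auto
    finally show ?thesis unfolding prob_flip_sign_vimage[OF N k] by simp
  qed
  have "?P (\<Union>k<n. M k) = (\<Sum>k<n. ?P (M k))"
    using disj by (intro measure_pmf.finite_measure_finite_Union) auto
  also have "\<dots> \<le> (\<Sum>k<n. 2 * ?P (M k \<inter> G))"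
    using step by (intro sum_mono) auto
  also have "\<dots> = 2 * ?P (\<Union>k<n. M k \<inter> G)"
    using disj by (subst measure_pmf.finite_measure_finite_Union)
      (auto simp: disjoint_family_on_def sum_distrib_left)
  also have "\<dots> \<le> 2 * ?P G"
    by (intro mult_left_mono measure_pmf.finite_measure_mono) auto
  finally show ?thesis unfolding U[symmetric] big_def G_def .
qed

text \<open>One large coordinate suffices. Coordinate \<open>k\<close> alone reaches the level
  \<open>h\<close> with probability at least |z k|^p / h - 1/N, and these numbers sum to 1 - n/N =
  1/2. By independence no coordinate is large with probability at most exp(-1/2) \<le> 2/3, and
  Levy's inequality halves the remaining 1/3.\<close>

lemma stable_form_anticoncentration:
  fixes z :: "nat \<Rightarrow> real"
  assumes p: "p > 0" and n: "n > 0" and N: "N = 2 * n"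
  shows "measure_pmf.prob (stable_row_pmf n N)
      {\<omega>. (\<Sum>k<n. \<bar>z k\<bar> powr p) \<le> \<bar>stable_form p N n z \<omega>\<bar> powr p} \<ge> 1 / 6"
proof -
  let ?P = "measure_pmf.prob (stable_row_pmf n N)"
  let ?\<nu> = "measure_pmf.prob (pmf_of_set (stable_ints N))"
  define h where "h = (\<Sum>k<n. \<bar>z k\<bar> powr p)"
  have h0: "h \<ge> 0" by (simp add: h_def sum_nonneg)
  have N0: "N > 0" using n N by simp
  show ?thesis
  proof (cases "h = 0")
    case True
    then have "{\<omega>. h \<le> \<bar>stable_form p N n z \<omega>\<bar> powr p} = UNIV" by simp
    then show ?thesis unfolding h_def[symmetric] by simp
  next
    case False
    with h0 have h: "h > 0" by simp
    define B where "B k = {w. h \<le> \<bar>stable_val p N w * z k\<bar> powr p}" for k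
    have q: "?\<nu> (B k) \<ge> \<bar>z k\<bar> powr p / h - 1 / real N" if k: "k < n" for k
    proof (cases "z k = 0")
      case False
      then have zk: "\<bar>z k\<bar> powr p > 0" by simp
      have "\<bar>z k\<bar> powr p \<le> h"
        unfolding h_def using k by (intro member_le_sum) auto
      then have s: "h / \<bar>z k\<bar> powr p \<ge> 1" using zk by simp
      have "B k = {w. h / \<bar>z k\<bar> powr p \<le> \<bar>stable_val p N w\<bar> powr p}"
        unfolding B_def using zk by (simp add: abs_mult powr_mult pos_divide_le_eq)
      then show ?thesis
        using prob_stable_val_ge_lower[OF p N0 s] by simp
    qed (use measure_nonneg[of _ "B k"] in \<open>simp add: order_trans[OF _ measure_nonneg]\<close>)
    have "(\<Sum>k<n. \<bar>z k\<bar> powr p / h - 1 / real N) = 1 / 2"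
      using h n by (simp add: sum_subtractf N h_def flip: sum_divide_distrib)
    then have q_sum: "(\<Sum>k<n. ?\<nu> (B k)) \<ge> 1 / 2"
      using sum_mono[of "{..<n}" "\<lambda>k. \<bar>z k\<bar> powr p / h - 1 / real N" "\<lambda>k. ?\<nu> (B k)"] q by simp
    have "?P (Pi {..<n} (\<lambda>k. - B k)) = (\<Prod>k<n. ?\<nu> (- B k))"
      unfolding stable_row_pmf_def by (intro measure_Pi_pmf_Pi) auto
    also have "\<dots> = (\<Prod>k<n. 1 - ?\<nu> (B k))"
      by (intro prod.cong refl) (subst measure_pmf.prob_compl[symmetric], auto simp: Compl_eq_Diff_UNIV)
    also have "\<dots> \<le> (\<Prod>k<n. exp (- ?\<nu> (B k)))"
    proof (intro prod_mono conjI)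
      fix k
      show "1 - ?\<nu> (B k) \<le> exp (- ?\<nu> (B k))"
        using exp_ge_add_one_self[of "- ?\<nu> (B k)"] by simp
    qed simp
    also have "\<dots> = exp (- (\<Sum>k<n. ?\<nu> (B k)))"
      by (simp add: exp_sum sum_negf[symmetric])
    also have "\<dots> \<le> exp (- (1 / 2))" using q_sum by simp
    also have "\<dots> \<le> 2 / 3"
      using exp_ge_add_one_self[of "1/2::real"] by (simp add: exp_minus field_simps)
    finally have "?P (Pi {..<n} (\<lambda>k. - B k)) \<le> 2 / 3" .
    moreover have "{\<omega>. \<exists>k<n. h \<le> \<bar>stable_val p N (\<omega> k) * z k\<bar> powr p} = UNIV - Pi {..<n} (\<lambda>k. - B k)"
      by (auto simp: B_def Pi_def)
    ultimately have "?P {\<omega>. \<exists>k<n. h \<le> \<bar>stable_val p N (\<omega> k) * z k\<bar> powr p} \<ge> 1 / 3"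
      using measure_pmf.prob_compl[of "Pi {..<n} (\<lambda>k. - B k)" "stable_row_pmf n N"] by simp
    then show ?thesis
      using levy_inequality[OF N0 p, of n h z] unfolding h_def by simp
  qed
qed

text \<open>Flipping the sign of one coordinate negates every cross term containing it, so only the
  diagonal survives. Any odd \<open>g k\<close> is allowed because truncation by absolute value
  preserves oddness.\<close>

lemma second_moment_odd_row:
  fixes b :: "nat \<Rightarrow> nat \<Rightarrow> real" and g :: "nat \<Rightarrow> int \<Rightarrow> real"
  assumes N: "N > 0" and odd: "\<And>k w. g k (- w) = - g k w"
  shows "measure_pmf.expectation (stable_row_pmf n N) (\<lambda>\<omega>. \<Sum>i<m. (\<Sum>k<n. g k (\<omega> k) * b k i)\<^sup>2)
    = (\<Sum>k<n. (\<Sum>i<m. (b k i)\<^sup>2) * measure_pmf.expectation (pmf_of_set (stable_ints N)) (\<lambda>w. (g k w)\<^sup>2))"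
proof -
  let ?E = "measure_pmf.expectation (stable_row_pmf n N)"
  have cross: "?E (\<lambda>\<omega>. g k (\<omega> k) * g l (\<omega> l)) = 0" if "k < n" "k \<noteq> l" for k l
  proof -
    have "?E (\<lambda>\<omega>. g k (\<omega> k) * g l (\<omega> l)) = ?E (\<lambda>\<omega>. g k (flip_sign k \<omega> k) * g l (flip_sign k \<omega> l))"
      by (rule expectation_flip_sign[OF N \<open>k < n\<close>, symmetric])
    also have "\<dots> = - ?E (\<lambda>\<omega>. g k (\<omega> k) * g l (\<omega> l))"
      using that by (simp add: flip_sign_def odd)
    finally show ?thesis by simp
  qed
  have diag: "?E (\<lambda>\<omega>. g k (\<omega> k) * g k (\<omega> k))
      = measure_pmf.expectation (pmf_of_set (stable_ints N)) (\<lambda>w. (g k w)\<^sup>2)" if "k < n" for k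
    using expectation_stable_row_component[OF that, of N "\<lambda>w. (g k w)\<^sup>2"] by (simp add: power2_eq_square)
  have "?E (\<lambda>\<omega>. \<Sum>i<m. (\<Sum>k<n. g k (\<omega> k) * b k i)\<^sup>2)
      = ?E (\<lambda>\<omega>. \<Sum>i<m. \<Sum>k<n. \<Sum>l<n. (b k i * b l i) * (g k (\<omega> k) * g l (\<omega> l)))"
    by (simp add: power2_eq_square sum_product mult_ac)
  also have "\<dots> = (\<Sum>i<m. \<Sum>k<n. \<Sum>l<n. (b k i * b l i) * ?E (\<lambda>\<omega>. g k (\<omega> k) * g l (\<omega> l)))"
    using N by simp
  also have "\<dots> = (\<Sum>i<m. \<Sum>k<n. \<Sum>l<n. if l = k then (b k i)\<^sup>2 * ?E (\<lambda>\<omega>. g k (\<omega> k) * g k (\<omega> k)) else 0)"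
    by (intro sum.cong refl) (auto simp: cross power2_eq_square)
  also have "\<dots> = (\<Sum>k<n. \<Sum>i<m. (b k i)\<^sup>2 * ?E (\<lambda>\<omega>. g k (\<omega> k) * g k (\<omega> k)))"
    by (subst sum.swap) simp
  also have "\<dots> = (\<Sum>k<n. (\<Sum>i<m. (b k i)\<^sup>2) * ?E (\<lambda>\<omega>. g k (\<omega> k) * g k (\<omega> k)))"
    by (simp add: sum_distrib_right)
  also have "\<dots> = (\<Sum>k<n. (\<Sum>i<m. (b k i)\<^sup>2)
      * measure_pmf.expectation (pmf_of_set (stable_ints N)) (\<lambda>w. (g k w)\<^sup>2))"
    by (intro sum.cong refl) (simp add: diag)
  finally show ?thesis .
qed

text \<open>Coordinate \<open>k\<close> is truncated where its own contribution |X_k|^p |b_k|^p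
  exceeds \<open>s\<close>. Some coordinate does so with probability at most D / s, where D is the
  sum of the |b_k|^p. For the truncated row, Markov's inequality for the second moment gives C * D /
  s: the bound on coordinate \<open>k\<close> is |b_k|^2 (s / |b_k|^p)^(2/p-1), which collapses to
  s^(2/p-1) |b_k|^p.\<close>

lemma stable_row_norm_tail:
  fixes b :: "nat \<Rightarrow> nat \<Rightarrow> real"
  assumes p: "0 < p" "p < 2" and N: "N > 0" and s: "s > 0"
  shows "measure_pmf.prob (stable_row_pmf n N)
      {\<omega>. s < (\<Sum>i<m. (stable_form p N n (\<lambda>k. b k i) \<omega>)\<^sup>2) powr (p / 2)}
    \<le> (1 + 2 powr (2 / p) / (2 / p - 1)) * (\<Sum>k<n. (\<Sum>i<m. (b k i)\<^sup>2) powr (p / 2)) / s"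
proof -
  let ?P = "measure_pmf.prob (stable_row_pmf n N)"
  let ?E = "measure_pmf.expectation (stable_row_pmf n N)"
  define C where "C = 2 powr (2 / p) / (2 / p - 1)"
  define B where "B k = (\<Sum>i<m. (b k i)\<^sup>2)" for k
  define \<beta> where "\<beta> k = B k powr (p / 2)" for k
  define D where "D = (\<Sum>k<n. \<beta> k)"
  have B0: "B k \<ge> 0" for k by (simp add: B_def sum_nonneg)
  have \<beta>0: "\<beta> k \<ge> 0" for k by (simp add: \<beta>_def)
  have B\<beta>: "B k = \<beta> k powr (2 / p)" for k
    using p B0[of k] by (simp add: \<beta>_def powr_powr)
  define g where "g k w = (if \<bar>stable_val p N w\<bar> powr p * \<beta> k \<le> s then stable_val p N w else 0)" for k w
  define Q' where "Q' \<omega> = (\<Sum>i<m. (\<Sum>k<n. g k (\<omega> k) * b k i)\<^sup>2)" for \<omega>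
  have Q'0: "Q' \<omega> \<ge> 0" for \<omega> by (simp add: Q'_def sum_nonneg)
  define Large where "Large = {\<omega>. \<exists>k<n. s < \<bar>stable_val p N (\<omega> k)\<bar> powr p * \<beta> k}"
  have "?P Large \<le> (\<Sum>k<n. ?P {\<omega>. s < \<bar>stable_val p N (\<omega> k)\<bar> powr p * \<beta> k})"
  proof -
    have "Large = (\<Union>k<n. {\<omega>. s < \<bar>stable_val p N (\<omega> k)\<bar> powr p * \<beta> k})"
      by (auto simp: Large_def)
    then show ?thesis
      by (simp only:) (intro measure_pmf.finite_measure_subadditive_finite, auto)
  qed
  also have "\<dots> \<le> (\<Sum>k<n. \<beta> k / s)"
  proof (intro sum_mono)
    fix k assume "k \<in> {..<n}"
    then have k: "k < n" by simp
    show "?P {\<omega>. s < \<bar>stable_val p N (\<omega> k)\<bar> powr p * \<beta> k} \<le> \<beta> k / s"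
    proof (cases "\<beta> k = 0")
      case False
      then have bk: "\<beta> k > 0" using \<beta>0[of k] by simp
      have "?P {\<omega>. s < \<bar>stable_val p N (\<omega> k)\<bar> powr p * \<beta> k}
          = measure_pmf.prob (pmf_of_set (stable_ints N)) {w. s < \<bar>stable_val p N w\<bar> powr p * \<beta> k}"
        by (rule prob_stable_row_component[OF k])
      also have "\<dots> \<le> measure_pmf.prob (pmf_of_set (stable_ints N)) {w. s / \<beta> k \<le> \<bar>stable_val p N w\<bar> powr p}"
        using bk by (intro measure_pmf.finite_measure_mono) (auto simp: field_simps)
      also have "\<dots> \<le> 1 / (s / \<beta> k)"
        using bk s p N by (intro prob_stable_val_ge_upper) auto
      finally show ?thesis by simp
    qed (use s in simp)
  qed
  also have "\<dots> = D / s" by (simp add: D_def sum_divide_distrib)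
  finally have large: "?P Large \<le> D / s" .
  have "?E Q' = (\<Sum>k<n. B k * measure_pmf.expectation (pmf_of_set (stable_ints N)) (\<lambda>w. (g k w)\<^sup>2))"
    unfolding Q'_def B_def by (rule second_moment_odd_row[OF N]) (simp add: g_def stable_val_uminus)
  also have "\<dots> \<le> (\<Sum>k<n. C * s powr (2 / p - 1) * \<beta> k)"
  proof (intro sum_mono)
    fix k
    show "B k * measure_pmf.expectation (pmf_of_set (stable_ints N)) (\<lambda>w. (g k w)\<^sup>2)
        \<le> C * s powr (2 / p - 1) * \<beta> k"
    proof (cases "\<beta> k = 0")
      case True
      then show ?thesis using B\<beta>[of k] by simp
    next
      case False
      then have bk: "\<beta> k > 0" using \<beta>0[of k] by simp
      have "(\<lambda>w. (g k w)\<^sup>2) = (\<lambda>w. if \<bar>stable_val p N w\<bar> powr p \<le> s / \<beta> k then (stable_val p N w)\<^sup>2 else 0)"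
        using bk by (auto simp: g_def field_simps)
      then have "measure_pmf.expectation (pmf_of_set (stable_ints N)) (\<lambda>w. (g k w)\<^sup>2)
          \<le> C * (s / \<beta> k) powr (2 / p - 1)"
        using stable_val_truncated_second_moment[OF p N, of "s / \<beta> k"] s bk by (simp add: C_def)
      then have "B k * measure_pmf.expectation (pmf_of_set (stable_ints N)) (\<lambda>w. (g k w)\<^sup>2)
          \<le> B k * (C * (s / \<beta> k) powr (2 / p - 1))"
        using B0 by (rule mult_left_mono)
      also have "\<dots> = C * s powr (2 / p - 1) * (\<beta> k powr (2 / p) / \<beta> k powr (2 / p - 1))"
        using s bk by (simp add: B\<beta> powr_divide)
      also have "\<beta> k powr (2 / p) / \<beta> k powr (2 / p - 1) = \<beta> k"
        using bk by (simp flip: powr_diff)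
      finally show ?thesis .
    qed
  qed
  also have "\<dots> = C * s powr (2 / p - 1) * D"
    by (simp add: D_def sum_distrib_left)
  finally have EQ: "?E Q' \<le> C * s powr (2 / p - 1) * D" .
  have "?P {\<omega>. s powr (2 / p) \<le> Q' \<omega>} \<le> ?E Q' / s powr (2 / p)"
    using integral_Markov_inequality_measure[of "measure_pmf (stable_row_pmf n N)" Q' "{}" "s powr (2 / p)"] N s Q'0 by simp
  also have "\<dots> \<le> C * s powr (2 / p - 1) * D / s powr (2 / p)"
    using EQ by (intro divide_right_mono) auto
  also have "\<dots> = C * D / s"
    using s by (simp add: powr_diff)
  finally have trunc: "?P {\<omega>. s powr (2 / p) \<le> Q' \<omega>} \<le> C * D / s" .
  have "{\<omega>. s < (\<Sum>i<m. (stable_form p N n (\<lambda>k. b k i) \<omega>)\<^sup>2) powr (p / 2)}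
      \<subseteq> Large \<union> {\<omega>. s powr (2 / p) \<le> Q' \<omega>}"
  proof
    fix \<omega> assume *: "\<omega> \<in> {\<omega>. s < (\<Sum>i<m. (stable_form p N n (\<lambda>k. b k i) \<omega>)\<^sup>2) powr (p / 2)}"
    show "\<omega> \<in> Large \<union> {\<omega>. s powr (2 / p) \<le> Q' \<omega>}"
    proof (cases "\<omega> \<in> Large")
      case False
      then have "\<bar>stable_val p N (\<omega> k)\<bar> powr p * \<beta> k \<le> s" if "k < n" for k
        using that unfolding Large_def mem_Collect_eq by (meson not_less)
      then have "g k (\<omega> k) = stable_val p N (\<omega> k)" if "k < n" for k
        using that by (simp add: g_def)
      then have "Q' \<omega> = (\<Sum>i<m. (stable_form p N n (\<lambda>k. b k i) \<omega>)\<^sup>2)"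
        by (simp add: Q'_def stable_form_def)
      then have "s < Q' \<omega> powr (p / 2)" and "Q' \<omega> \<ge> 0" using * by (auto simp: Q'_def sum_nonneg)
      then have "s powr (2 / p) \<le> (Q' \<omega> powr (p / 2)) powr (2 / p)"
        using s p by (intro powr_mono2) auto
      also have "\<dots> = Q' \<omega>" using p \<open>Q' \<omega> \<ge> 0\<close> by (simp add: powr_powr)
      finally show ?thesis by simp
    qed simp
  qed
  then have "?P {\<omega>. s < (\<Sum>i<m. (stable_form p N n (\<lambda>k. b k i) \<omega>)\<^sup>2) powr (p / 2)}
      \<le> ?P (Large \<union> {\<omega>. s powr (2 / p) \<le> Q' \<omega>})"
    by (intro measure_pmf.finite_measure_mono) auto
  also have "\<dots> \<le> ?P Large + ?P {\<omega>. s powr (2 / p) \<le> Q' \<omega>}"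
    by (intro measure_Un_le) auto
  also have "\<dots> \<le> D / s + C * D / s" using large trunc by simp
  also have "\<dots> = (1 + C) * D / s" by (simp add: add_divide_distrib distrib_right)
  finally show ?thesis unfolding C_def D_def \<beta>_def B_def .
qed

section \<open>Sums of independent heavy-tailed variables\<close>

lemma Pi_pmf_prob_component:
  assumes "finite I" and "i \<in> I"
  shows "measure_pmf.prob (Pi_pmf I dflt (\<lambda>_. R)) {F. P (F i)} = measure_pmf.prob R {x. P x}"
proof -
  have "measure_pmf.prob (map_pmf (\<lambda>F. F i) (Pi_pmf I dflt (\<lambda>_. R))) {x. P x}
      = measure_pmf.prob (Pi_pmf I dflt (\<lambda>_. R)) {F. P (F i)}"
    by (subst measure_map_pmf) (simp add: vimage_def)
  then show ?thesis using assms by (simp add: Pi_pmf_component)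
qed

lemma Pi_pmf_expectation_component:
  assumes "finite I" and "i \<in> I"
  shows "measure_pmf.expectation (Pi_pmf I dflt (\<lambda>_. R)) (\<lambda>F. g (F i)) = measure_pmf.expectation R (g :: _ \<Rightarrow> real)"
  using integral_map_pmf[of "\<lambda>F. F i" "Pi_pmf I dflt (\<lambda>_. R)" g] assms
  by (simp add: Pi_pmf_component)

lemma finite_set_Pi_pmf:
  assumes "finite I" and "finite (set_pmf R)"
  shows "finite (set_pmf (Pi_pmf I dflt (\<lambda>_. R)))"
  using assms by (simp add: set_Pi_pmf finite_PiE_dflt o_def)

text \<open>If 2^j * D is the largest dyadic threshold below \<open>x\<close>, the single layer
  \<open>j\<close> already contributes 2^(j+1) * D, which is at least \<open>x\<close>; values up to
  \<open>D\<close> are covered by the leading term.\<close>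

lemma dyadic_layer_bound:
  fixes x D :: real
  assumes "x \<le> 2 ^ J * D" and "D \<ge> 0"
  shows "x \<le> D + (\<Sum>j<J. 2 ^ Suc j * D * indicator {y. 2 ^ j * D < y} x)"
  using assms(1)
proof (induction J)
  case (Suc J)
  have nonneg: "(\<Sum>j<J. 2 ^ Suc j * D * indicator {y. 2 ^ j * D < y} x) \<ge> 0"
    using assms(2) by (intro sum_nonneg) auto
  show ?case
  proof (cases "x \<le> 2 ^ J * D")
    case True
    have "2 ^ Suc J * D * indicator {y. 2 ^ J * D < y} x \<ge> 0" using assms(2) by simp
    with Suc.IH[OF True] show ?thesis unfolding sum.lessThan_Suc by linarith
  next
    case False
    then have "indicator {y. 2 ^ J * D < y} x = (1::real)" by simp
    then have "2 ^ Suc J * D * indicator {y. 2 ^ J * D < y} x = 2 ^ Suc J * D" by simp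
    with Suc.prems nonneg assms(2) show ?thesis unfolding sum.lessThan_Suc by linarith
  qed
qed simp

text \<open>Each variable is truncated at \<open>2 ^ J * D\<close>, where \<open>2 ^ J\<close> is a large multiple of \<open>r\<close>;
  each of the \<open>J\<close> dyadic layers below contributes \<open>O(c D)\<close> to its expectation.\<close>

lemma sum_weak_moment_tail:
  fixes W :: "'a \<Rightarrow> real"
  assumes R: "finite (set_pmf R)" and D: "D > 0" and c: "c \<ge> 0" and W0: "\<And>x. W x \<ge> 0"
    and tail: "\<And>s. s > 0 \<Longrightarrow> measure_pmf.prob R {x. s < W x} \<le> c * D / s"
    and r: "r > 0" and J: "2 ^ J \<ge> 1000 * c * real r"
  shows "measure_pmf.prob (Pi_pmf {..<r} dflt (\<lambda>_. R))
      {F. 1000 * real r * D * (1 + 2 * c * real J) < (\<Sum>i<r. W (F i))} \<le> 1 / 500"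
proof -
  define Q where "Q = Pi_pmf {..<r} dflt (\<lambda>_. R)"
  define K where "K = 1000 * real r * D * (1 + 2 * c * real J)"
  have K: "K > 0" unfolding K_def using r D c by (intro mult_pos_pos add_pos_nonneg) auto
  define ind where "ind j x = (indicator {y. 2 ^ j * D < y} (W x) :: real)" for j x
  define U where "U x = D + (\<Sum>j<J. 2 ^ Suc j * D * ind j x)" for x
  have intR: "integrable (measure_pmf R) f" for f :: "'a \<Rightarrow> real"
    using R by (rule integrable_measure_pmf_finite)
  have intQ: "integrable (measure_pmf Q) f" for f :: "(nat \<Rightarrow> 'a) \<Rightarrow> real"
    unfolding Q_def using R by (intro integrable_measure_pmf_finite finite_set_Pi_pmf) auto
  have U0: "U x \<ge> 0" for x unfolding U_def ind_def using D by (intro add_nonneg_nonneg sum_nonneg) auto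
  have E_ind: "measure_pmf.expectation R (ind j) = measure_pmf.prob R {x. 2 ^ j * D < W x}" for j
  proof -
    have "ind j = indicator {x. 2 ^ j * D < W x}" by (auto simp: ind_def indicator_def)
    then show ?thesis by simp
  qed
  have "measure_pmf.expectation R U = D + (\<Sum>j<J. 2 ^ Suc j * D * measure_pmf.expectation R (ind j))"
    unfolding U_def by (simp add: intR)
  also have "\<dots> = D + (\<Sum>j<J. 2 ^ Suc j * D * measure_pmf.prob R {x. 2 ^ j * D < W x})"
    by (simp only: E_ind)
  \<comment> \<open>With tails of order 1/s, height times probability is \<open>2 * c * D\<close> in
    every layer; this makes the number \<open>J\<close> of layers appear as a factor.\<close>
  also have "\<dots> \<le> D + (\<Sum>j<J. 2 ^ Suc j * D * (c * D / (2 ^ j * D)))"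
    using D by (intro add_left_mono sum_mono mult_left_mono tail) auto
  also have "\<dots> = D * (1 + 2 * c * real J)"
    using D by (simp add: field_simps)
  finally have EU: "measure_pmf.expectation R U \<le> D * (1 + 2 * c * real J)" .
  have "measure_pmf.expectation Q (\<lambda>F. \<Sum>i<r. U (F i)) = (\<Sum>i<r. measure_pmf.expectation Q (\<lambda>F. U (F i)))"
    by (intro Bochner_Integration.integral_sum intQ)
  also have "\<dots> = real r * measure_pmf.expectation R U"
    unfolding Q_def by (simp add: Pi_pmf_expectation_component)
  also have "\<dots> \<le> K / 1000"
    using EU r by (simp add: K_def mult.assoc)
  finally have EQ: "measure_pmf.expectation Q (\<lambda>F. \<Sum>i<r. U (F i)) \<le> K / 1000" .
  have "measure_pmf.prob Q {F. K \<le> (\<Sum>i<r. U (F i))} \<le> measure_pmf.expectation Q (\<lambda>F. \<Sum>i<r. U (F i)) / K"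
    using integral_Markov_inequality_measure[of "measure_pmf Q" "\<lambda>F. \<Sum>i<r. U (F i)" "{}" K] K intQ U0
    by (simp add: sum_nonneg)
  also have "\<dots> \<le> (K / 1000) / K" using EQ K by (intro divide_right_mono) auto
  finally have mean: "measure_pmf.prob Q {F. K \<le> (\<Sum>i<r. U (F i))} \<le> 1 / 1000" using K by simp
  \<comment> \<open>Above the truncation level nothing is averaged: the union bound over
    \<open>r\<close> variables costs c * r / 2^J, at most 1/1000 by the choice of
    \<open>J\<close>.\<close>
  define Large where "Large = (\<Union>i<r. {F. 2 ^ J * D < W (F i)})"
  have "measure_pmf.prob Q Large \<le> (\<Sum>i<r. measure_pmf.prob Q {F. 2 ^ J * D < W (F i)})"
    unfolding Large_def by (intro measure_pmf.finite_measure_subadditive_finite) auto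
  also have "\<dots> \<le> (\<Sum>i<r. c * D / (2 ^ J * D))"
  proof (intro sum_mono)
    fix i assume "i \<in> {..<r}"
    then show "measure_pmf.prob Q {F. 2 ^ J * D < W (F i)} \<le> c * D / (2 ^ J * D)"
      unfolding Q_def by (subst Pi_pmf_prob_component[where P = "\<lambda>x. 2 ^ J * D < W x"])
        (use D tail[of "2 ^ J * D"] in auto)
  qed
  also have "\<dots> = c * real r / 2 ^ J" using D by simp
  also have "\<dots> \<le> 1 / 1000" using J by (simp add: field_simps)
  finally have large: "measure_pmf.prob Q Large \<le> 1 / 1000" .
  have "{F. K < (\<Sum>i<r. W (F i))} \<subseteq> Large \<union> {F. K \<le> (\<Sum>i<r. U (F i))}"
  proof
    fix F assume F: "F \<in> {F. K < (\<Sum>i<r. W (F i))}"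
    show "F \<in> Large \<union> {F. K \<le> (\<Sum>i<r. U (F i))}"
    proof (cases "F \<in> Large")
      case False
      then have "W (F i) \<le> 2 ^ J * D" if "i < r" for i
        using that unfolding Large_def by (simp add: not_less)
      then have "(\<Sum>i<r. W (F i)) \<le> (\<Sum>i<r. U (F i))"
        unfolding U_def ind_def using D by (intro sum_mono dyadic_layer_bound) auto
      then show ?thesis using F by simp
    qed simp
  qed
  then have "measure_pmf.prob Q {F. K < (\<Sum>i<r. W (F i))}
      \<le> measure_pmf.prob Q (Large \<union> {F. K \<le> (\<Sum>i<r. U (F i))})"
    by (intro measure_pmf.finite_measure_mono) auto
  also have "\<dots> \<le> measure_pmf.prob Q Large + measure_pmf.prob Q {F. K \<le> (\<Sum>i<r. U (F i))}"
    by (intro measure_Un_le) auto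
  finally show ?thesis using mean large unfolding K_def Q_def by simp
qed

text \<open>Exponential Markov inequality for exp(-V/h), which is bounded however heavy the tail of
  \<open>V\<close> is. Its mean is at most 1 - (1/6)(1/2) = 1 - 1/12, because it is at most exp(-1)
  \<le> 1/2 when \<open>V\<close> reaches \<open>h\<close>. The threshold r * h / 24 gives back half
  of the exponent r / 12.\<close>

lemma sum_lower_tail:
  fixes V :: "'a \<Rightarrow> real"
  assumes R: "finite (set_pmf R)" and h: "h > 0" and V0: "\<And>x. V x \<ge> 0"
    and big: "measure_pmf.prob R {x. h \<le> V x} \<ge> 1 / 6"
  shows "measure_pmf.prob (Pi_pmf {..<r} dflt (\<lambda>_. R))
      {F. (\<Sum>i<r. V (F i)) < real r * h / 24} \<le> exp (- (real r / 24))"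
proof -
  define Q where "Q = Pi_pmf {..<r} dflt (\<lambda>_. R)"
  have intR: "integrable (measure_pmf R) f" for f :: "'a \<Rightarrow> real"
    using R by (rule integrable_measure_pmf_finite)
  have intQ: "integrable (measure_pmf Q) f" for f :: "(nat \<Rightarrow> 'a) \<Rightarrow> real"
    unfolding Q_def using R by (intro integrable_measure_pmf_finite finite_set_Pi_pmf) auto
  have e1: "exp (- 1) \<le> (1 / 2 :: real)"
    using exp_ge_add_one_self[of "1::real"] by (simp add: exp_minus field_simps)
  have "measure_pmf.expectation R (\<lambda>x. exp (- V x / h))
      \<le> measure_pmf.expectation R (\<lambda>x. 1 - 1 / 2 * indicator {x. h \<le> V x} x)"
  proof (intro integral_mono intR)
    fix x
    show "exp (- V x / h) \<le> 1 - 1 / 2 * indicator {x. h \<le> V x} x"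
    proof (cases "h \<le> V x")
      case True
      then have "exp (- V x / h) \<le> exp (- 1)" using h by (simp add: field_simps)
      from order_trans[OF this e1] True show ?thesis by simp
    next
      case False
      then show ?thesis using h V0[of x] by simp
    qed
  qed
  also have "\<dots> = 1 - 1 / 2 * measure_pmf.prob R {x. h \<le> V x}"
    by (simp add: intR)
  also have "\<dots> \<le> 1 + (- (1 / 12))" using big by simp
  also have "\<dots> \<le> exp (- (1 / 12))" by (rule exp_ge_add_one_self)
  finally have E1: "measure_pmf.expectation R (\<lambda>x. exp (- V x / h)) \<le> exp (- (1 / 12))" .
  have "measure_pmf.expectation Q (\<lambda>F. \<Prod>i<r. exp (- V (F i) / h))
      = (\<Prod>i<r. measure_pmf.expectation R (\<lambda>x. exp (- V x / h)))"
    unfolding Q_def by (intro expectation_prod_Pi_pmf intR) auto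
  also have "\<dots> \<le> (\<Prod>i<r. exp (- (1 / 12)))"
    using E1 by (intro prod_mono conjI) (auto intro!: integral_nonneg)
  also have "\<dots> = exp (- (real r / 12))"
    by (simp flip: exp_of_nat_mult)
  finally have E2: "measure_pmf.expectation Q (\<lambda>F. \<Prod>i<r. exp (- V (F i) / h)) \<le> exp (- (real r / 12))" .
  have "{F. (\<Sum>i<r. V (F i)) < real r * h / 24}
      \<subseteq> {F. exp (- (real r / 24)) \<le> (\<Prod>i<r. exp (- V (F i) / h))}"
  proof
    fix F assume "F \<in> {F. (\<Sum>i<r. V (F i)) < real r * h / 24}"
    then have "(\<Sum>i<r. V (F i)) / h \<le> real r / 24" using h by (simp add: field_simps)
    then show "F \<in> {F. exp (- (real r / 24)) \<le> (\<Prod>i<r. exp (- V (F i) / h))}"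
      by (simp add: sum_negf sum_divide_distrib flip: exp_sum)
  qed
  then have "measure_pmf.prob Q {F. (\<Sum>i<r. V (F i)) < real r * h / 24}
      \<le> measure_pmf.prob Q {F. exp (- (real r / 24)) \<le> (\<Prod>i<r. exp (- V (F i) / h))}"
    by (intro measure_pmf.finite_measure_mono) auto
  also have "\<dots> \<le> measure_pmf.expectation Q (\<lambda>F. \<Prod>i<r. exp (- V (F i) / h)) / exp (- (real r / 24))"
    using integral_Markov_inequality_measure[of "measure_pmf Q" "\<lambda>F. \<Prod>i<r. exp (- V (F i) / h)" "{}"
        "exp (- (real r / 24))"] intQ
    by (simp add: prod_nonneg)
  also have "\<dots> \<le> exp (- (real r / 12)) / exp (- (real r / 24))"
    using E2 by (intro divide_right_mono) auto
  also have "\<dots> = exp (- (real r / 24))" by (simp flip: exp_diff)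
  finally show ?thesis unfolding Q_def .
qed

definition stable_mat_pmf :: "nat \<Rightarrow> nat \<Rightarrow> nat \<Rightarrow> (nat \<Rightarrow> nat \<Rightarrow> int) pmf" where
  "stable_mat_pmf r n N = Pi_pmf {..<r} (\<lambda>_. 0) (\<lambda>_. stable_row_pmf n N)"

section \<open>From a grid to all vectors\<close>

definition lin_psum :: "real \<Rightarrow> nat \<Rightarrow> nat \<Rightarrow> (nat \<Rightarrow> nat \<Rightarrow> real) \<Rightarrow> (nat \<Rightarrow> real) \<Rightarrow> real" where
  "lin_psum p n m b y = (\<Sum>k<n. \<bar>\<Sum>j<m. y j * b k j\<bar> powr p)"

text \<open>An upper bound for the p-th power of the norm of \<open>b\<close> as an operator from
  the Euclidean norm to the p-norm, by Cauchy-Schwarz in each row.\<close>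

definition row_psum :: "real \<Rightarrow> nat \<Rightarrow> nat \<Rightarrow> (nat \<Rightarrow> nat \<Rightarrow> real) \<Rightarrow> real" where
  "row_psum p n m b = (\<Sum>k<n. (\<Sum>j<m. (b k j)\<^sup>2) powr (p / 2))"

lemma lin_psum_nonneg [simp]: "lin_psum p n m b y \<ge> 0"
  by (simp add: lin_psum_def sum_nonneg)

lemma row_psum_nonneg [simp]: "row_psum p n m b \<ge> 0"
  by (simp add: row_psum_def sum_nonneg)

text \<open>The larger of the two parts has at least half the size of \<open>u\<close>, and 2^p
  \<le> 4.\<close>

lemma powr_abs_le_4:
  fixes u v p :: real
  assumes "0 < p" "p \<le> 2"
  shows "\<bar>u\<bar> powr p \<le> 4 * (\<bar>v\<bar> powr p + \<bar>u - v\<bar> powr p)"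
proof -
  define w where "w = max \<bar>v\<bar> \<bar>u - v\<bar>"
  have "\<bar>v\<bar> \<le> w" "\<bar>u - v\<bar> \<le> w" by (simp_all add: w_def)
  then have "\<bar>u\<bar> \<le> 2 * w" by linarith
  then have "\<bar>u\<bar> powr p \<le> (2 * w) powr p"
    using assms by (intro powr_mono2) auto
  also have "\<dots> = 2 powr p * w powr p" by (simp add: powr_mult w_def)
  also have "\<dots> \<le> 2 powr 2 * w powr p"
    using assms by (intro mult_right_mono powr_mono) auto
  also have "2 powr 2 = (4::real)" by simp
  also have "w powr p \<le> \<bar>v\<bar> powr p + \<bar>u - v\<bar> powr p"
    by (auto simp: w_def max_def)
  finally show ?thesis by simp
qed

lemma lin_psum_le_4:
  assumes "0 < p" "p \<le> 2"
  shows "lin_psum p n m b y \<le> 4 * (lin_psum p n m b z + lin_psum p n m b (\<lambda>j. y j - z j))"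
proof -
  have "lin_psum p n m b y \<le> (\<Sum>k<n. 4 * (\<bar>\<Sum>j<m. z j * b k j\<bar> powr p
      + \<bar>(\<Sum>j<m. y j * b k j) - (\<Sum>j<m. z j * b k j)\<bar> powr p))"
    unfolding lin_psum_def by (intro sum_mono powr_abs_le_4 assms)
  also have "\<dots> = 4 * (lin_psum p n m b z + lin_psum p n m b (\<lambda>j. y j - z j))"
    by (simp add: lin_psum_def sum.distrib sum_distrib_left left_diff_distrib sum_subtractf)
  finally show ?thesis .
qed

lemma lin_psum_le_row_psum:
  assumes "p > 0"
  shows "lin_psum p n m b y \<le> row_psum p n m b * (\<Sum>j<m. (y j)\<^sup>2) powr (p / 2)"
proof -
  have "\<bar>\<Sum>j<m. y j * b k j\<bar> powr p
      \<le> (\<Sum>j<m. (b k j)\<^sup>2) powr (p / 2) * (\<Sum>j<m. (y j)\<^sup>2) powr (p / 2)" for k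
  proof -
    have "\<bar>\<Sum>j<m. y j * b k j\<bar> powr p = (\<bar>\<Sum>j<m. y j * b k j\<bar> powr 2) powr (p / 2)"
      by (simp add: powr_powr del: powr_numeral)
    also have "\<dots> = ((\<Sum>j<m. y j * b k j)\<^sup>2) powr (p / 2)" by simp
    also have "\<dots> \<le> ((\<Sum>j<m. (y j)\<^sup>2) * (\<Sum>j<m. (b k j)\<^sup>2)) powr (p / 2)"
      using assms by (intro powr_mono2 Cauchy_Schwarz_ineq_sum) auto
    finally show ?thesis by (simp add: powr_mult sum_nonneg mult.commute)
  qed
  then show ?thesis
    unfolding lin_psum_def row_psum_def sum_distrib_right by (intro sum_mono) auto
qed

lemma lin_psum_scale:
  assumes "t \<ge> 0"
  shows "lin_psum p n m b (\<lambda>j. t * y j) = t powr p * lin_psum p n m b y"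
  using assms
  by (simp add: lin_psum_def mult.assoc abs_mult powr_mult sum_distrib_left[symmetric])

text \<open>Numerators of a mesh 1/M grid on the whole cube around the unit ball. Keeping all points
  of the cube, not only those near the sphere, makes counting immediate; the exponent is of order d
  log M either way.\<close>

definition int_grid :: "nat \<Rightarrow> nat \<Rightarrow> (nat \<Rightarrow> int) set" where
  "int_grid m M = PiE_dflt {..<m} 0 (\<lambda>_. {- int M..int M})"

lemma finite_int_grid [simp]: "finite (int_grid m M)"
  by (auto simp: int_grid_def)

lemma card_int_grid: "card (int_grid m M) = (2 * M + 1) ^ m"
  unfolding int_grid_def by (subst card_PiE_dflt) (auto simp: nat_add_distrib nat_mult_distrib)

lemma int_grid_approx:
  assumes M: "M > 0" and y: "\<And>j. j < m \<Longrightarrow> \<bar>y j\<bar> \<le> (1::real)"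
  shows "\<exists>g\<in>int_grid m M. (\<Sum>j<m. (y j - real_of_int (g j) / real M)\<^sup>2) \<le> (real m / real M)\<^sup>2"
proof (intro bexI)
  define g where "g j = (if j < m then \<lfloor>real M * y j\<rfloor> else 0)" for j
  have "\<lfloor>real M * y j\<rfloor> \<in> {- int M..int M}" if "j < m" for j
  proof -
    have "\<bar>real M * y j\<bar> \<le> real M * 1"
      unfolding abs_mult using y[OF that] by (intro mult_mono) auto
    then have "real_of_int (- int M) \<le> real M * y j" "real M * y j \<le> real_of_int (int M)"
      by auto
    then show ?thesis unfolding atLeastAtMost_iff by (metis floor_mono floor_of_int)
  qed
  then show "g \<in> int_grid m M" by (auto simp: int_grid_def PiE_dflt_def g_def)
  have "(\<Sum>j<m. (y j - real_of_int (g j) / real M)\<^sup>2) \<le> (\<Sum>j<m. (1 / real M)\<^sup>2)"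
  proof (intro sum_mono)
    fix j assume "j \<in> {..<m}"
    then have "real_of_int (g j) = of_int \<lfloor>real M * y j\<rfloor>" by (simp add: g_def)
    then have "\<bar>real M * y j - real_of_int (g j)\<bar> \<le> 1" by linarith
    then have "\<bar>(real M * y j - real_of_int (g j)) / real M\<bar> \<le> 1 / real M"
      by (simp add: abs_divide divide_right_mono)
    then show "(y j - real_of_int (g j) / real M)\<^sup>2 \<le> (1 / real M)\<^sup>2"
      using M by (intro power2_le_iff_abs_le[THEN iffD2]) (simp_all add: diff_divide_distrib)
  qed
  also have "\<dots> = real m / (real M)\<^sup>2" by (simp add: power_divide)
  \<comment> \<open>The crude m \<le> m^2 produces a perfect square, whose power p/2 is simply
    (m/M)^p.\<close>
  also have "\<dots> \<le> (real m)\<^sup>2 / (real M)\<^sup>2"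
    by (intro divide_right_mono) (auto simp: power2_eq_square simp flip: of_nat_mult)
  finally show "(\<Sum>j<m. (y j - real_of_int (g j) / real M)\<^sup>2) \<le> (real m / real M)\<^sup>2"
    by (simp add: power_divide)
qed

text \<open>By homogeneity \<open>y\<close> may have Euclidean norm 1, and then the last hypothesis
  says that its power sum under \<open>b\<close> is at least 1/2. Rounding to the grid changes both
  sides by additive amounts of order m/M times the operator bounds; \<open>fine\<close> makes these
  small against \<open>\<theta>\<close>, so they are absorbed into a positive multiple of the left
  side.\<close>

lemma lower_bound_from_grid:
  assumes p: "1 \<le> p" "p < 2" and M: "M > 0"
    and \<theta>: "\<theta> > 0"
    and fine: "real m / real M * (\<theta> * row_psum p n m b + row_psum p r m c) \<le> \<theta> / 64"
    and mM: "m \<le> M"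
    and grid: "\<And>g. g \<in> int_grid m M \<Longrightarrow>
      \<theta> * lin_psum p n m b (\<lambda>j. real_of_int (g j) / real M)
        \<le> lin_psum p r m c (\<lambda>j. real_of_int (g j) / real M)"
    and y: "(\<Sum>j<m. (y j)\<^sup>2) powr (p / 2) \<le> 2 * lin_psum p n m b y"
  shows "\<theta> / 32 * lin_psum p n m b y \<le> lin_psum p r m c y"
proof -
  have unit: "\<theta> / 32 * lin_psum p n m b y \<le> lin_psum p r m c y"
    if Y: "(\<Sum>j<m. (y j)\<^sup>2) = 1" and half: "1 \<le> 2 * lin_psum p n m b y" for y
  proof -
    have "\<bar>y j\<bar> \<le> 1" if "j < m" for j
    proof -
      have "(y j)\<^sup>2 \<le> (\<Sum>j<m. (y j)\<^sup>2)" using that by (intro member_le_sum) auto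
      then show ?thesis using Y by (simp add: abs_square_le_1)
    qed
    then obtain g where g: "g \<in> int_grid m M"
      and close: "(\<Sum>j<m. (y j - real_of_int (g j) / real M)\<^sup>2) \<le> (real m / real M)\<^sup>2"
      using int_grid_approx[OF M, of m y] by blast
    define z where "z j = real_of_int (g j) / real M" for j
    define e where "e = (\<Sum>j<m. (y j - z j)\<^sup>2) powr (p / 2)"
    have "e \<le> ((real m / real M)\<^sup>2) powr (p / 2)"
      unfolding e_def z_def using close p by (intro powr_mono2) (auto intro: sum_nonneg)
    also have "\<dots> = (real m / real M) powr p"
    proof (cases "m = 0")
      case False
      then have "((real m / real M)\<^sup>2) powr (p / 2) = ((real m / real M) powr 2) powr (p / 2)"
        using M by simp
      also have "\<dots> = (real m / real M) powr p" by (simp add: powr_powr del: powr_numeral)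
      finally show ?thesis .
    qed simp
    \<comment> \<open>A base at most 1 raised to \<open>p \<ge> 1\<close> only shrinks, so the error
      is linear in the mesh for every \<open>p\<close>.\<close>
    also have "\<dots> \<le> (real m / real M) powr 1"
      using p mM M by (intro powr_mono') auto
    finally have e: "e \<le> real m / real M" using M by simp
    have eb: "lin_psum p n m b (\<lambda>j. y j - z j) \<le> row_psum p n m b * e"
      and ec: "lin_psum p r m c (\<lambda>j. z j - y j) \<le> row_psum p r m c * e"
      using lin_psum_le_row_psum[of p n m b "\<lambda>j. y j - z j"] lin_psum_le_row_psum[of p r m c "\<lambda>j. z j - y j"] p
      by (simp_all add: e_def power2_commute)
    have "lin_psum p n m b y \<le> 4 * (lin_psum p n m b z + row_psum p n m b * e)"
      using lin_psum_le_4[of p n m b y z] eb p by simp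
    then have "\<theta> * lin_psum p n m b y \<le> \<theta> * (4 * (lin_psum p n m b z + row_psum p n m b * e))"
      using \<theta> by (intro mult_left_mono) auto
    also have "\<dots> = 4 * (\<theta> * lin_psum p n m b z) + 4 * (e * (\<theta> * row_psum p n m b))"
      by (simp add: algebra_simps)
    also have "\<theta> * lin_psum p n m b z \<le> lin_psum p r m c z"
      using grid[OF g] by (simp add: z_def[abs_def])
    also have "lin_psum p r m c z \<le> 4 * (lin_psum p r m c y + row_psum p r m c * e)"
      using lin_psum_le_4[of p r m c z y] ec p by simp
    finally have "\<theta> * lin_psum p n m b y
        \<le> 16 * lin_psum p r m c y + 16 * (e * (row_psum p r m c)) + 4 * (e * (\<theta> * row_psum p n m b))"
      by (simp add: algebra_simps)
    also have "\<dots> \<le> 16 * lin_psum p r m c y + 16 * (e * (\<theta> * row_psum p n m b + row_psum p r m c))"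
    proof -
      have "e * (\<theta> * row_psum p n m b) \<ge> 0" using \<theta> by (simp add: e_def)
      then show ?thesis by (simp add: algebra_simps)
    qed
    also have "e * (\<theta> * row_psum p n m b + row_psum p r m c)
        \<le> real m / real M * (\<theta> * row_psum p n m b + row_psum p r m c)"
      using e \<theta> by (intro mult_right_mono) auto
    also note fine
    finally have *: "\<theta> * lin_psum p n m b y \<le> 16 * lin_psum p r m c y + \<theta> / 4" by simp
    \<comment> \<open>The error \<open>\<theta> / 4\<close> is at most half of the left side. The 16
      from two quasi-triangle inequalities thus becomes 32.\<close>
    have "\<theta> * 1 \<le> \<theta> * (2 * lin_psum p n m b y)"
      using half \<theta> by (intro mult_left_mono) auto
    with * show ?thesis by simp
  qed
  define Y where "Y = (\<Sum>j<m. (y j)\<^sup>2)"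
  show ?thesis
  proof (cases "Y = 0")
    case True
    then have "y j = 0" if "j < m" for j
      using that by (simp add: Y_def sum_nonneg_eq_0_iff)
    then have "lin_psum p n m b y = 0" by (simp add: lin_psum_def)
    then show ?thesis by simp
  next
    case False
    then have Y: "Y > 0" using sum_nonneg[of "{..<m}" "\<lambda>j. (y j)\<^sup>2"] by (auto simp: Y_def less_le)
    define t where "t = 1 / sqrt Y"
    have t: "t > 0" using Y by (simp add: t_def)
    have tp: "t powr p * Y powr (p / 2) = 1"
      using Y by (simp add: t_def powr_half_sqrt[symmetric] powr_divide powr_powr)
    have "\<theta> / 32 * lin_psum p n m b (\<lambda>j. t * y j) \<le> lin_psum p r m c (\<lambda>j. t * y j)"
    proof (rule unit)
      have "(\<Sum>j<m. (t * y j)\<^sup>2) = t\<^sup>2 * Y"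
        by (simp add: power_mult_distrib Y_def sum_distrib_left)
      then show "(\<Sum>j<m. (t * y j)\<^sup>2) = 1"
        using Y by (simp add: t_def power_divide)
      have "t powr p * Y powr (p / 2) \<le> t powr p * (2 * lin_psum p n m b y)"
        using y by (intro mult_left_mono) (auto simp: Y_def)
      then show "1 \<le> 2 * lin_psum p n m b (\<lambda>j. t * y j)"
        using t tp by (simp add: lin_psum_scale)
    qed
    then have "t powr p * (\<theta> / 32 * lin_psum p n m b y) \<le> t powr p * lin_psum p r m c y"
      using t by (simp add: lin_psum_scale mult_ac)
    then show ?thesis using t by simp
  qed
qed

lemma stable_form_combination:
  "stable_form p N n (\<lambda>k. \<Sum>j<m. y j * b k j) \<omega> = (\<Sum>j<m. y j * stable_form p N n (\<lambda>k. b k j) \<omega>)"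
proof -
  have "stable_form p N n (\<lambda>k. \<Sum>j<m. y j * b k j) \<omega>
      = (\<Sum>k<n. \<Sum>j<m. y j * (stable_val p N (\<omega> k) * b k j))"
    by (simp add: stable_form_def sum_distrib_left mult_ac)
  also have "\<dots> = (\<Sum>j<m. y j * stable_form p N n (\<lambda>k. b k j) \<omega>)"
    by (subst sum.swap) (simp add: stable_form_def sum_distrib_left)
  finally show ?thesis .
qed

text \<open>The basis of \<open>a\<close> enters only the analysis, through two bad events: a large
  sum of row norms, and failed contraction at some grid point. Each has probability at most 1/500,
  and off both the two bounds hold for all \<open>x\<close> simultaneously. The constants are 768 =
  24 * 32, from the Chernoff and grid steps, and 4000 = 1000 * 2 * 2, from Markov's inequality and
  the two factors 2 of the Lewis basis.\<close>

lemma stable_mat_pmf_embedding: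
  fixes a :: "nat \<Rightarrow> nat \<Rightarrow> real"
  assumes p: "1 \<le> p" "p < 2" and n: "n > 0" and N: "N = 2 * n" and d: "d > 0" and r: "r > 0"
    and c: "c = 1 + 2 powr (2 / p) / (2 / p - 1)"
    and J: "2 ^ J \<ge> 1000 * c * real r"
    and M: "real M \<ge> 4000000 * (real d)\<^sup>2 * (1 + 2 * c * real J)"
    and net: "real (2 * M + 1) ^ d * exp (- (real r / 24)) \<le> 1 / 500"
  shows "measure_pmf.prob (stable_mat_pmf r n N)
     {F. \<forall>x. real r / 768 * lin_psum p n d a x
              \<le> (\<Sum>i<r. \<bar>stable_form p N n (\<lambda>k. \<Sum>j<d. x j * a k j) (F i)\<bar> powr p)
          \<and> (\<Sum>i<r. \<bar>stable_form p N n (\<lambda>k. \<Sum>j<d. x j * a k j) (F i)\<bar> powr p)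
              \<le> 4000 * real r * real d * (1 + 2 * c * real J) * lin_psum p n d a x} \<ge> 99 / 100"
    (is "measure_pmf.prob ?Q ?Good \<ge> _")
proof -
  have N0: "N > 0" using n N by simp
  have p0: "0 < p" using p by simp
  have c1: "c \<ge> 1" using p by (simp add: c field_simps)
  obtain m b where m: "m \<le> d"
    and repr: "\<And>x. \<exists>y. (\<forall>k<n. (\<Sum>j<d. x j * a k j) = (\<Sum>i<m. y i * b k i))
        \<and> (\<Sum>i<m. (y i)\<^sup>2) powr (p / 2) \<le> 2 * lin_psum p n d a x"
    and rows: "row_psum p n m b \<le> 2 * real d"
    using lewis_basis[OF p, of d n a] unfolding lin_psum_def row_psum_def by blast
  define K where "K = 1000 * real r * (2 * real d) * (1 + 2 * c * real J)"
  define cf where "cf F i j = stable_form p N n (\<lambda>k. b k j) (F i)"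
    for F :: "nat \<Rightarrow> nat \<Rightarrow> int" and i j :: nat
  have form: "(\<Sum>i<r. \<bar>stable_form p N n (\<lambda>k. \<Sum>j<m. y j * b k j) (F i)\<bar> powr p)
      = lin_psum p r m (cf F) y" for F y
    by (simp add: stable_form_combination lin_psum_def cf_def)
  define Bad1 where "Bad1 = {F. K < row_psum p r m (cf F)}"
  define Bad2 where "Bad2 g = {F. lin_psum p r m (cf F) (\<lambda>j. real_of_int (g j) / real M)
      < real r / 24 * lin_psum p n m b (\<lambda>j. real_of_int (g j) / real M)}" for g
  have "measure_pmf.prob ?Q Bad1 \<le> 1 / 500"
    unfolding Bad1_def K_def row_psum_def cf_def stable_mat_pmf_def
  proof (intro sum_weak_moment_tail finite_set_stable_row_pmf N0 r J)
    fix s :: real assume s: "s > 0"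
    have "measure_pmf.prob (stable_row_pmf n N)
        {\<omega>. s < (\<Sum>j<m. (stable_form p N n (\<lambda>k. b k j) \<omega>)\<^sup>2) powr (p / 2)} \<le> c * row_psum p n m b / s"
      unfolding row_psum_def c by (rule stable_row_norm_tail[OF p0 p(2) N0 s])
    also have "\<dots> \<le> c * (2 * real d) / s"
      using rows c1 s by (intro divide_right_mono mult_left_mono) auto
    finally show "measure_pmf.prob (stable_row_pmf n N)
        {\<omega>. s < (\<Sum>j<m. (stable_form p N n (\<lambda>k. b k j) \<omega>)\<^sup>2) powr (p / 2)} \<le> c * (2 * real d) / s" .
  qed (use c1 d in auto)
  moreover have "measure_pmf.prob ?Q (\<Union>g\<in>int_grid m M. Bad2 g) \<le> 1 / 500"
  proof -
    have each: "measure_pmf.prob ?Q (Bad2 g) \<le> exp (- (real r / 24))" for g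
    proof -
      define z where "z k = (\<Sum>j<m. real_of_int (g j) / real M * b k j)" for k
      define h where "h = (\<Sum>k<n. \<bar>z k\<bar> powr p)"
      have hz: "lin_psum p n m b (\<lambda>j. real_of_int (g j) / real M) = h"
        by (simp add: lin_psum_def h_def z_def)
      show ?thesis
      proof (cases "h = 0")
        case True
        \<comment> \<open>\<open>Bad2\<close> is defined by a strict inequality, so it cannot hold
          when the right side is 0.\<close>
        then have "Bad2 g = {}" by (auto simp: Bad2_def hz not_less)
        then show ?thesis by simp
      next
        case False
        then have h: "h > 0" using sum_nonneg[of "{..<n}" "\<lambda>k. \<bar>z k\<bar> powr p"] by (auto simp: h_def less_le)
        have "measure_pmf.prob ?Q {F. (\<Sum>i<r. \<bar>stable_form p N n z (F i)\<bar> powr p) < real r * h / 24}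
            \<le> exp (- (real r / 24))"
          unfolding stable_mat_pmf_def
          by (intro sum_lower_tail[where V = "\<lambda>\<omega>. \<bar>stable_form p N n z \<omega>\<bar> powr p"] finite_set_stable_row_pmf N0 h)
            (use stable_form_anticoncentration[OF p0 n N, of z] in \<open>auto simp: h_def\<close>)
        also have "{F. (\<Sum>i<r. \<bar>stable_form p N n z (F i)\<bar> powr p) < real r * h / 24} = Bad2 g"
          unfolding Bad2_def hz form[symmetric] by (simp add: z_def[abs_def])
        finally show ?thesis .
      qed
    qed
    have "measure_pmf.prob ?Q (\<Union>g\<in>int_grid m M. Bad2 g) \<le> (\<Sum>g\<in>int_grid m M. measure_pmf.prob ?Q (Bad2 g))"
      by (intro measure_pmf.finite_measure_subadditive_finite) auto
    also have "\<dots> \<le> (\<Sum>g\<in>int_grid m M. exp (- (real r / 24)))"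
      by (intro sum_mono each)
    also have "\<dots> = real (2 * M + 1) ^ m * exp (- (real r / 24))"
      by (simp add: card_int_grid)
    also have "\<dots> \<le> real (2 * M + 1) ^ d * exp (- (real r / 24))"
      using m by (intro mult_right_mono power_increasing) auto
    finally show ?thesis using net by simp
  qed
  ultimately have bad: "measure_pmf.prob ?Q (Bad1 \<union> (\<Union>g\<in>int_grid m M. Bad2 g)) \<le> 1 / 100"
    using measure_Un_le[of Bad1 ?Q "\<Union>g\<in>int_grid m M. Bad2 g"] by simp
  have J1: "1 + 2 * c * real J \<ge> 1" using c1 by simp
  have d1: "real d \<ge> 1" using d by simp
  have Mbig: "real M \<ge> 4000000 * (real d)\<^sup>2"
  proof -
    have "4000000 * (real d)\<^sup>2 * 1 \<le> 4000000 * (real d)\<^sup>2 * (1 + 2 * c * real J)"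
      using J1 by (intro mult_left_mono) auto
    with M show ?thesis by simp
  qed
  have "(real d)\<^sup>2 \<ge> real d" using d1 by (simp add: power2_eq_square)
  with Mbig d1 have dM: "real d \<le> real M" by linarith
  with d have M0: "M > 0" by simp
  have good: "F \<in> ?Good" if F: "F \<notin> Bad1 \<union> (\<Union>g\<in>int_grid m M. Bad2 g)" for F
  proof -
    have up: "row_psum p r m (cf F) \<le> K" using F by (simp add: Bad1_def)
    have low: "real r / 24 * lin_psum p n m b (\<lambda>j. real_of_int (g j) / real M)
        \<le> lin_psum p r m (cf F) (\<lambda>j. real_of_int (g j) / real M)" if "g \<in> int_grid m M" for g
      using F that by (auto simp: Bad2_def not_less)
    have fine: "real m / real M * (real r / 24 * row_psum p n m b + row_psum p r m (cf F)) \<le> real r / 24 / 64"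
    proof -
      have "real r / 24 * row_psum p n m b + row_psum p r m (cf F)
          \<le> real r / 24 * (2 * real d) + K"
        using up rows by (intro add_mono mult_left_mono) auto
      also have "\<dots> \<le> real r * real d * (1 + 2 * c * real J) + K"
      proof -
        have "real r * real d * 1 \<le> real r * real d * (1 + 2 * c * real J)"
          using J1 by (intro mult_left_mono) auto
        moreover have "real r / 24 * (2 * real d) = real r * real d / 12" by simp
        moreover have "real r * real d \<ge> 0" by simp
        ultimately show ?thesis by linarith
      qed
      also have "\<dots> = 2001 * real r * real d * (1 + 2 * c * real J)"
        by (simp add: K_def algebra_simps)
      finally have s: "real r / 24 * row_psum p n m b + row_psum p r m (cf F)
          \<le> 2001 * real r * real d * (1 + 2 * c * real J)" .
      have "real m * (real r / 24 * row_psum p n m b + row_psum p r m (cf F))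
          \<le> real d * (2001 * real r * real d * (1 + 2 * c * real J))"
        using m s by (intro mult_mono) auto
      also have "\<dots> = real r * (2001 * (real d)\<^sup>2 * (1 + 2 * c * real J))"
        by (simp add: power2_eq_square)
      \<comment> \<open>Here 1536 = 24 * 64, and the constant in the hypothesis on \<open>M\<close>
        is a round number above 2001 * 1536.\<close>
      also have "\<dots> \<le> real r * (real M / 1536)"
      proof (intro mult_left_mono)
        define q where "q = (real d)\<^sup>2 * (1 + 2 * c * real J)"
        have "q \<ge> 0" using J1 by (simp add: q_def)
        moreover have "4000000 * q \<le> real M" using M by (simp add: q_def mult.assoc)
        ultimately have "2001 * q \<le> real M / 1536" by simp
        then show "2001 * (real d)\<^sup>2 * (1 + 2 * c * real J) \<le> real M / 1536"
          unfolding q_def mult.assoc[of 2001 "(real d)\<^sup>2"] .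
      qed simp
      finally show ?thesis using M0 by (simp add: field_simps)
    qed
    show ?thesis
    proof (intro CollectI allI)
      fix x
      obtain y where y: "\<And>k. k < n \<Longrightarrow> (\<Sum>j<d. x j * a k j) = (\<Sum>i<m. y i * b k i)"
        and Y: "(\<Sum>i<m. (y i)\<^sup>2) powr (p / 2) \<le> 2 * lin_psum p n d a x"
        using repr by blast
      have e1: "lin_psum p n d a x = lin_psum p n m b y"
        unfolding lin_psum_def using y by (intro sum.cong) auto
      have "stable_form p N n (\<lambda>k. \<Sum>j<d. x j * a k j) \<omega>
          = stable_form p N n (\<lambda>k. \<Sum>j<m. y j * b k j) \<omega>" for \<omega>
        unfolding stable_form_def using y by (intro sum.cong) auto
      then have e2: "(\<Sum>i<r. \<bar>stable_form p N n (\<lambda>k. \<Sum>j<d. x j * a k j) (F i)\<bar> powr p)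
          = lin_psum p r m (cf F) y"
        by (simp add: form)
      have "real r / 24 / 32 * lin_psum p n m b y \<le> lin_psum p r m (cf F) y"
        using r m dM Y by (intro lower_bound_from_grid[OF p M0 _ fine _ low]) (auto simp: e1)
      moreover have "lin_psum p r m (cf F) y \<le> 2 * K * lin_psum p n m b y"
      proof -
        have "lin_psum p r m (cf F) y \<le> row_psum p r m (cf F) * (\<Sum>j<m. (y j)\<^sup>2) powr (p / 2)"
          by (rule lin_psum_le_row_psum[OF p0])
        also have "\<dots> \<le> K * (2 * lin_psum p n m b y)"
          using up Y by (intro mult_mono) (auto simp: e1 intro: order_trans[OF row_psum_nonneg])
        finally show ?thesis by simp
      qed
      ultimately show "real r / 768 * lin_psum p n d a x
              \<le> (\<Sum>i<r. \<bar>stable_form p N n (\<lambda>k. \<Sum>j<d. x j * a k j) (F i)\<bar> powr p)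
          \<and> (\<Sum>i<r. \<bar>stable_form p N n (\<lambda>k. \<Sum>j<d. x j * a k j) (F i)\<bar> powr p)
              \<le> 4000 * real r * real d * (1 + 2 * c * real J) * lin_psum p n d a x"
        unfolding e1 e2 K_def by (simp add: mult_ac)
    qed
  qed
  then have "UNIV - (Bad1 \<union> (\<Union>g\<in>int_grid m M. Bad2 g)) \<subseteq> ?Good" by blast
  then have "measure_pmf.prob ?Q (UNIV - (Bad1 \<union> (\<Union>g\<in>int_grid m M. Bad2 g))) \<le> measure_pmf.prob ?Q ?Good"
    by (intro measure_pmf.finite_measure_mono) auto
  then show ?thesis
    using bad measure_pmf.prob_compl[of "Bad1 \<union> (\<Union>g\<in>int_grid m M. Bad2 g)" ?Q] by simp
qed

section \<open>Choice of the number of rows, the truncation depth and the grid size\<close>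

lemma log1_ge_1: "log1 t \<ge> 1"
  by (simp add: log1_def)

lemma ln_le_log1: "ln t \<le> log1 t"
  by (simp add: log1_def)

text \<open>Resolves the circular choice of the constant \<open>x\<close> in r = x * d * log d: the
  logarithm of the grid size depends on \<open>x\<close> only through an iterated logarithm, which
  the linear right side overtakes.\<close>

lemma exists_dominating_ln:
  fixes B c A :: real
  assumes "c > 0"
  shows "\<exists>x\<ge>1. 24 * (B + ln (1 + 2 * c * (A + 2 * ln x))) \<le> x"
proof -
  have "eventually (\<lambda>x. 24 * (B + ln (1 + 2 * c * (A + 2 * ln x))) \<le> x) at_top"
    using assms by real_asymp
  then have "eventually (\<lambda>x. x \<ge> 1 \<and> 24 * (B + ln (1 + 2 * c * (A + 2 * ln x))) \<le> x) at_top"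
    using eventually_ge_at_top[of 1] by eventually_elim auto
  then show ?thesis by (auto dest: eventually_happens)
qed

text \<open>\<open>r\<close> is fixed as a multiple of d log d, then \<open>J\<close> as the
  logarithm of a multiple of \<open>r\<close>, then \<open>M\<close> from \<open>d\<close> and
  \<open>J\<close>. What needs proof is that the union bound over the grid still closes for this
  \<open>r\<close>, with a constant that does not depend on \<open>d\<close>.\<close>

lemma embedding_parameters:
  fixes c :: real
  assumes c: "c \<ge> 1"
  shows "\<exists>C>0. \<forall>d::nat. d \<ge> 1 \<longrightarrow> (\<exists>r J M. r > 0
      \<and> real r \<le> C * (real d * log1 (real d)) \<and> real J \<le> C * log1 (real d)
      \<and> 2 ^ J \<ge> 1000 * c * real r
      \<and> real M \<ge> 4000000 * (real d)\<^sup>2 * (1 + 2 * c * real J)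
      \<and> real (2 * M + 1) ^ d * exp (- (real r / 24)) \<le> 1 / 500)"
proof -
  define E :: real where "E = 4000000"
  define A where "A = ln (2000 * c)"
  have A: "A \<ge> 0" using c by (simp add: A_def)
  \<comment> \<open>The terms come from the constant factor in the bound for 2 * M + 1, from ln(d^2)
    + ln L \<le> 3 * L, and from the failure probability 1/500.\<close>
  define B where "B = ln (2 * E + 3) + 3 + ln 500"
  obtain C0 where C0: "C0 \<ge> 1" and C0_dom: "24 * (B + ln (1 + 2 * c * ((2 * A + 5) + 2 * ln C0))) \<le> C0"
    using exists_dominating_ln[of c B "2 * A + 5"] c by auto
  define C1 where "C1 = (2 * A + 5) + 2 * ln C0"
  have C1: "C1 \<ge> 0" using A C0 by (simp add: C1_def)
  have main: "\<exists>r J M. r > 0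
      \<and> real r \<le> (2 * C0 + C1) * (real d * log1 (real d)) \<and> real J \<le> (2 * C0 + C1) * log1 (real d)
      \<and> 2 ^ J \<ge> 1000 * c * real r
      \<and> real M \<ge> 4000000 * (real d)\<^sup>2 * (1 + 2 * c * real J)
      \<and> real (2 * M + 1) ^ d * exp (- (real r / 24)) \<le> 1 / 500" if d: "d \<ge> 1" for d :: nat
  proof -
    define L where "L = log1 (real d)"
    have L: "L \<ge> 1" by (simp add: L_def log1_ge_1)
    have d1: "real d \<ge> 1" using d by simp
    have ln_d: "ln (real d) \<le> L" by (simp add: L_def ln_le_log1)
    have ln_L: "ln L \<le> L" using ln_le_minus_one[of L] L by simp
    have dL: "real d * L \<ge> 1" using mult_mono[OF d1 L] d1 by simp
    have CdL: "C0 * (real d * L) \<ge> 1" using mult_mono[OF C0 dL] C0 by simp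
    define r where "r = nat \<lceil>C0 * (real d * L)\<rceil>"
    have r_ge: "real r \<ge> C0 * (real d * L)" unfolding r_def by (rule real_nat_ceiling_ge)
    have r0: "r > 0" using r_ge CdL by (cases "r = 0") auto
    have "real r \<le> C0 * (real d * L) + 1" using CdL unfolding r_def by linarith
    \<comment> \<open>The 1 lost by rounding up is at most \<open>C0 * (real d * L)\<close>
      itself.\<close>
    then have r_le: "real r \<le> 2 * C0 * (real d * L)" using CdL by simp
    define X where "X = 1000 * c * real r"
    define J where "J = nat \<lceil>log 2 X\<rceil>"
    have r1: "real r \<ge> 1" using r0 by simp
    have cr: "c * real r \<ge> 1" using mult_mono[OF c r1] c by simp
    have X1: "X \<ge> 1" using cr by (simp add: X_def)
    then have lncr: "ln X \<ge> 0" by simp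
    have "log 2 X \<le> real J" unfolding J_def by (rule real_nat_ceiling_ge)
    then have "X \<le> 2 powr real J" using X1 by (subst (asm) log_le_iff) auto
    then have J_ge: "2 ^ J \<ge> X" by (simp add: powr_realpow)
    have h1: "log 2 X \<le> 2 * ln X"
    proof -
      have "(1::real) / ln 2 \<le> 2" using ln2_ge_two_thirds by (simp add: field_simps)
      then have "ln X * (1 / ln 2) \<le> ln X * 2"
        using lncr by (intro mult_left_mono) auto
      then show ?thesis by (simp add: log_def mult.commute)
    qed
    have h2: "real J \<le> log 2 X + 1"
    proof -
      have "log 2 X \<ge> 0" using lncr by (simp add: log_def)
      then show ?thesis unfolding J_def by linarith
    qed
    have h3: "ln X \<le> A + ln C0 + 2 * L"
    proof -
      have "X \<le> 1000 * c * (2 * C0 * (real d * L))"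
        unfolding X_def using r_le c by (intro mult_left_mono) auto
      then have "ln X \<le> ln (1000 * c * (2 * C0 * (real d * L)))"
        using X1 by (intro ln_mono) auto
      also have "1000 * c * (2 * C0 * (real d * L)) = (2000 * c) * (C0 * (real d * L))" by simp
      also have "ln \<dots> = A + (ln C0 + (ln (real d) + ln L))"
        unfolding A_def using c C0 d1 L by (subst ln_mult_pos, simp_all add: ln_mult_pos)
      also have "\<dots> \<le> A + ln C0 + 2 * L" using ln_d ln_L by simp
      finally show ?thesis .
    qed
    note h2
    also have "log 2 X + 1 \<le> 2 * ln X + 1" using h1 by simp
    also have "2 * ln X + 1 \<le> 2 * (A + ln C0 + 2 * L) + 1" using h3 by simp
    also have "\<dots> \<le> C1 * L"
    proof -
      have "(2 * A + 2 * ln C0 + 1) * 1 \<le> (2 * A + 2 * ln C0 + 1) * L"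
        using A C0 L by (intro mult_left_mono) auto
      then show ?thesis by (simp add: C1_def algebra_simps)
    qed
    finally have J_le: "real J \<le> C1 * L" .
    define M where "M = nat \<lceil>E * (real d)\<^sup>2 * (1 + 2 * c * real J)\<rceil>"
    have M_ge: "real M \<ge> E * (real d)\<^sup>2 * (1 + 2 * c * real J)"
      unfolding M_def by (rule real_nat_ceiling_ge)
    have J1: "1 + 2 * c * real J \<ge> 1" using c by simp
    have d2: "(real d)\<^sup>2 \<ge> 1" using d1 by simp
    have dJ: "(real d)\<^sup>2 * (1 + 2 * c * real J) \<ge> 1" using mult_mono[OF d2 J1] d2 by simp
    have "real M \<le> E * (real d)\<^sup>2 * (1 + 2 * c * real J) + 1"
    proof -
      have "E * (real d)\<^sup>2 * (1 + 2 * c * real J) \<ge> 0" using J1 by (simp add: E_def)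
      then show ?thesis unfolding M_def by linarith
    qed
    then have "real (2 * M + 1) \<le> (2 * E + 3) * ((real d)\<^sup>2 * (1 + 2 * c * real J))"
      using dJ by (simp add: algebra_simps)
    then have "ln (real (2 * M + 1)) \<le> ln ((2 * E + 3) * ((real d)\<^sup>2 * (1 + 2 * c * real J)))"
      by (intro ln_mono) auto
    also have "\<dots> = ln (2 * E + 3) + (ln ((real d)\<^sup>2) + ln (1 + 2 * c * real J))"
      using J1 d1 by (simp add: ln_mult_pos E_def)
    also have "ln ((real d)\<^sup>2) = 2 * ln (real d)" using d1 by (simp add: ln_realpow)
    also have "ln (1 + 2 * c * real J) \<le> ln ((1 + 2 * c * C1) * L)"
    proof (intro ln_mono)
      have "2 * c * real J \<le> 2 * c * (C1 * L)" using c J_le by (intro mult_left_mono) auto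
      then show "1 + 2 * c * real J \<le> (1 + 2 * c * C1) * L" using L by (simp add: algebra_simps)
    qed (use J1 in auto)
    also have "\<dots> = ln (1 + 2 * c * C1) + ln L"
      using c C1 L by (intro ln_mult_pos add_pos_nonneg) auto
    finally have "ln (real (2 * M + 1)) \<le> ln (2 * E + 3) + ln (1 + 2 * c * C1) + 3 * L"
      using ln_d ln_L by simp
    also have "\<dots> \<le> (ln (2 * E + 3) + 3 + ln (1 + 2 * c * C1)) * L"
    proof -
      have "(ln (2 * E + 3) + ln (1 + 2 * c * C1)) * 1 \<le> (ln (2 * E + 3) + ln (1 + 2 * c * C1)) * L"
        using c C1 L by (intro mult_left_mono add_nonneg_nonneg ln_ge_zero) (auto simp: E_def)
      then show ?thesis by (simp add: algebra_simps)
    qed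
    finally have "real d * ln (real (2 * M + 1)) \<le> real d * ((ln (2 * E + 3) + 3 + ln (1 + 2 * c * C1)) * L)"
      by (intro mult_left_mono) auto
    moreover have "ln 500 \<le> ln 500 * (real d * L)"
      using mult_left_mono[OF dL, of "ln 500"] by simp
    ultimately have "real d * ln (real (2 * M + 1)) + ln 500
        \<le> real d * ((ln (2 * E + 3) + 3 + ln (1 + 2 * c * C1)) * L) + ln 500 * (real d * L)"
      by (rule add_mono)
    also have "\<dots> = (B + ln (1 + 2 * c * C1)) * (real d * L)"
      by (simp add: B_def algebra_simps)
    also have "\<dots> \<le> (C0 / 24) * (real d * L)"
      using C0_dom dL by (intro mult_right_mono) (auto simp: C1_def)
    also have "\<dots> \<le> real r / 24" using r_ge by simp
    finally have "real d * ln (real (2 * M + 1)) - real r / 24 \<le> - ln 500" by simp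
    then have le: "exp (real d * ln (real (2 * M + 1)) - real r / 24) \<le> exp (- ln 500)" by simp
    have pos: "real (2 * M + 1) > 0" by simp
    have "exp (real d * ln (real (2 * M + 1))) = real (2 * M + 1) ^ d"
      unfolding exp_of_nat_mult exp_ln[OF pos] ..
    then have "real (2 * M + 1) ^ d * exp (- (real r / 24))
        = exp (real d * ln (real (2 * M + 1))) * exp (- (real r / 24))"
      by (simp only:)
    also have "\<dots> = exp (real d * ln (real (2 * M + 1)) - real r / 24)"
      unfolding diff_conv_add_uminus exp_add ..
    also note le
    also have "exp (- ln 500) = (1 / 500 :: real)" by (simp add: exp_minus)
    finally have net: "real (2 * M + 1) ^ d * exp (- (real r / 24)) \<le> 1 / 500" .
    have "2 * C0 * (real d * L) \<le> (2 * C0 + C1) * (real d * L)"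
      using C1 dL by (intro mult_right_mono) auto
    with r_le have "real r \<le> (2 * C0 + C1) * (real d * L)" by (rule order_trans)
    moreover have "C1 * L \<le> (2 * C0 + C1) * L"
      using C0 L by (intro mult_right_mono) auto
    with J_le have "real J \<le> (2 * C0 + C1) * L" by (rule order_trans)
    ultimately show ?thesis
      using r0 J_ge M_ge net unfolding L_def E_def X_def by blast
  qed
  show ?thesis
    by (rule exI[of _ "2 * C0 + C1"]) (use main C0 C1 in auto)
qed

section \<open>Matrices\<close>

lemma lp_norm_mult_mat_vec:
  assumes "B \<in> carrier_mat r d" and "x \<in> carrier_vec d"
  shows "lp_norm p (B *\<^sub>v x) = lin_psum p r d (\<lambda>i j. B $$ (i, j)) (vec_index x) powr (1 / p)"
proof -
  have "\<bar>vec_index (B *\<^sub>v x) i\<bar> powr p = \<bar>\<Sum>j<d. vec_index x j * B $$ (i, j)\<bar> powr p" if "i < r" for i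
    using that assms
    by (simp add: scalar_prod_def lessThan_atLeast0 mult.commute)
  then show ?thesis
    using assms by (simp add: lp_norm_def lin_psum_def)
qed

lemma measurable_mat_entry:
  assumes "i < r" "k < n"
  shows "(\<lambda>S. S $$ (i, k)) \<in> borel_measurable (borel_mat r n)"
proof -
  let ?f = "\<lambda>S. \<lambda>ij\<in>{..<r} \<times> {..<n}. (S :: real mat) $$ ij"
  have "?f \<in> measurable (borel_mat r n) (\<Pi>\<^sub>M ij\<in>{..<r} \<times> {..<n}. borel)"
    unfolding borel_mat_def by (intro measurable_vimage_algebra1) (auto simp: space_PiM)
  from measurable_compose[OF this measurable_component_singleton[of "(i, k)"]] assms
  show ?thesis by simp
qed

lemma space_borel_mat [simp]: "space (borel_mat r n) = carrier_mat r n"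
  by (simp add: borel_mat_def)

lemma measurable_lin_psum_mult:
  assumes A: "A \<in> carrier_mat n d"
  shows "(\<lambda>S. lin_psum p r d (\<lambda>i j. (S * A) $$ (i, j)) x) \<in> borel_measurable (borel_mat r n)"
proof -
  have "(\<lambda>S. \<Sum>i<r. \<bar>\<Sum>j<d. x j * (\<Sum>k<n. S $$ (i, k) * A $$ (k, j))\<bar> powr p)
      \<in> borel_measurable (borel_mat r n)"
    by (intro borel_measurable_sum powr_real_measurable borel_measurable_abs borel_measurable_times
        borel_measurable_const measurable_mat_entry) auto
  also have "?this \<longleftrightarrow> ?thesis"
  proof (intro measurable_cong)
    fix S assume S: "S \<in> space (borel_mat r n)"
    have "(S * A) $$ (i, j) = (\<Sum>k<n. S $$ (i, k) * A $$ (k, j))" if "i < r" "j < d" for i j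
      using that S A by (simp add: scalar_prod_def lessThan_atLeast0)
    then show "(\<Sum>i<r. \<bar>\<Sum>j<d. x j * (\<Sum>k<n. S $$ (i, k) * A $$ (k, j))\<bar> powr p)
        = lin_psum p r d (\<lambda>i j. (S * A) $$ (i, j)) x"
      by (simp add: lin_psum_def)
  qed
  finally show ?thesis .
qed

lemma tendsto_lin_psum:
  assumes "p > 0" and "\<And>j. j < m \<Longrightarrow> (\<lambda>l. X l j) \<longlonglongrightarrow> y j"
  shows "(\<lambda>l. lin_psum p n m b (X l)) \<longlonglongrightarrow> lin_psum p n m b y"
  unfolding lin_psum_def using assms
  by (intro tendsto_sum tendsto_powr' tendsto_rabs tendsto_mult tendsto_const) auto

lemma rational_vec_approx:
  fixes x :: "real Matrix.vec"
  assumes "x \<in> carrier_vec d"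
  shows "\<exists>X. (\<forall>l. X l \<in> carrier_vec d \<and> (\<forall>j<d. vec_index (X l) j \<in> \<rat>))
    \<and> (\<forall>j<d. (\<lambda>l. vec_index (X l) j) \<longlonglongrightarrow> vec_index x j)"
proof -
  have "\<exists>q. (\<forall>l. q l \<in> \<rat>) \<and> q \<longlonglongrightarrow> t" for t :: real
  proof -
    have "t \<in> closure \<rat>" by (simp add: Rats_closure_real)
    then show ?thesis by (auto simp: closure_sequential)
  qed
  then obtain q where q: "\<And>t l. q t l \<in> \<rat>" "\<And>t :: real. q t \<longlonglongrightarrow> t"
    by metis
  show ?thesis
    by (rule exI[of _ "\<lambda>l. vec d (\<lambda>j. q (vec_index x j) l)"]) (use q in auto)
qed

lemma countable_rational_vecs: "countable {x \<in> carrier_vec d. \<forall>j<d. vec_index x j \<in> (\<rat> :: real set)}"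
proof -
  have "{x \<in> carrier_vec d. \<forall>j<d. vec_index x j \<in> (\<rat> :: real set)}
      \<subseteq> vec_of_list ` {xs. set xs \<subseteq> \<rat>}"
  proof
    fix x :: "real Matrix.vec"
    assume x: "x \<in> {x \<in> carrier_vec d. \<forall>j<d. vec_index x j \<in> \<rat>}"
    then have "set (list_of_vec x) \<subseteq> \<rat>"
      by (auto simp: set_list_of_vec vec_set_def)
    then show "x \<in> vec_of_list ` {xs. set xs \<subseteq> \<rat>}"
      by (intro image_eqI[of _ _ "list_of_vec x"]) (simp_all add: vec_list)
  qed
  moreover have "countable {xs :: real list. set xs \<subseteq> \<rat>}"
    using countable_lists[OF countable_rat] by (simp add: lists_eq_set)
  ultimately show ?thesis by (meson countable_image countable_subset)
qed

text \<open>The event is an uncountable intersection over \<open>x\<close>. Both norms are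
  continuous in \<open>x\<close>, so the inequalities for rational \<open>x\<close> imply all others
  by passing to limits, and a countable intersection of measurable sets remains.\<close>

lemma sets_embedding_event:
  assumes A: "A \<in> carrier_mat n d" and p: "p > 0"
  shows "{S \<in> carrier_mat r n. \<forall>x \<in> carrier_vec d.
      lp_norm p (A *\<^sub>v x) \<le> lp_norm p (S * A *\<^sub>v x) \<and>
      lp_norm p (S * A *\<^sub>v x) \<le> \<kappa> * lp_norm p (A *\<^sub>v x)} \<in> sets (borel_mat r n)"
proof -
  define u where "u x = lin_psum p n d (\<lambda>i j. A $$ (i, j)) (vec_index x) powr (1 / p)" for x
  define w where "w S x = lin_psum p r d (\<lambda>i j. (S * A) $$ (i, j)) (vec_index x) powr (1 / p)" for S x
  define Q where "Q = {x \<in> carrier_vec d. \<forall>j<d. vec_index x j \<in> (\<rat> :: real set)}"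
  have u: "lp_norm p (A *\<^sub>v x) = u x" if "x \<in> carrier_vec d" for x
    unfolding u_def using A that by (rule lp_norm_mult_mat_vec)
  have w: "lp_norm p (S * A *\<^sub>v x) = w S x" if "S \<in> carrier_mat r n" "x \<in> carrier_vec d" for S x
    unfolding w_def using A that by (intro lp_norm_mult_mat_vec) auto
  have dense: "u x \<le> w S x \<and> w S x \<le> \<kappa> * u x"
    if Q: "\<forall>x\<in>Q. u x \<le> w S x \<and> w S x \<le> \<kappa> * u x" and x: "x \<in> carrier_vec d" for S x
  proof -
    obtain X where X: "\<And>l. X l \<in> Q" and lim: "\<And>j. j < d \<Longrightarrow> (\<lambda>l. vec_index (X l) j) \<longlonglongrightarrow> vec_index x j"
      using rational_vec_approx[OF x] unfolding Q_def by blast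
    have lu: "(\<lambda>l. u (X l)) \<longlonglongrightarrow> u x"
      unfolding u_def using p lim by (intro tendsto_powr' tendsto_lin_psum tendsto_const) auto
    have lw: "(\<lambda>l. w S (X l)) \<longlonglongrightarrow> w S x"
      unfolding w_def using p lim by (intro tendsto_powr' tendsto_lin_psum tendsto_const) auto
    show ?thesis
      using X Q LIMSEQ_le[OF lu lw] LIMSEQ_le[OF lw tendsto_mult[OF tendsto_const lu, of \<kappa>]] by blast
  qed
  have "{S \<in> space (borel_mat r n). \<forall>x\<in>Q. u x \<le> w S x \<and> w S x \<le> \<kappa> * u x} \<in> sets (borel_mat r n)"
  proof -
    have "{S \<in> space (borel_mat r n). u x \<le> w S x \<and> w S x \<le> \<kappa> * u x} \<in> sets (borel_mat r n)" for x
    proof -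
      have m: "(\<lambda>S. w S x) \<in> borel_measurable (borel_mat r n)"
        unfolding w_def
        by (intro powr_real_measurable measurable_lin_psum_mult[OF A] borel_measurable_const)
      show ?thesis
        using m by (intro sets.sets_Collect_conj borel_measurable_le borel_measurable_const)
    qed
    moreover have "countable Q" unfolding Q_def by (rule countable_rational_vecs)
    \<comment> \<open>A nonempty index set is needed for the intersection to stay inside the
      space.\<close>
    moreover have "0\<^sub>v d \<in> Q" by (simp add: Q_def)
    ultimately have "(\<Inter>x\<in>Q. {S \<in> space (borel_mat r n). u x \<le> w S x \<and> w S x \<le> \<kappa> * u x}) \<in> sets (borel_mat r n)"
      by (intro sets.countable_INT') auto
    also have "(\<Inter>x\<in>Q. {S \<in> space (borel_mat r n). u x \<le> w S x \<and> w S x \<le> \<kappa> * u x})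
        = {S \<in> space (borel_mat r n). \<forall>x\<in>Q. u x \<le> w S x \<and> w S x \<le> \<kappa> * u x}"
      using \<open>0\<^sub>v d \<in> Q\<close> by blast
    finally show ?thesis .
  qed
  also have "{S \<in> space (borel_mat r n). \<forall>x\<in>Q. u x \<le> w S x \<and> w S x \<le> \<kappa> * u x}
      = {S \<in> carrier_mat r n. \<forall>x \<in> carrier_vec d. u x \<le> w S x \<and> w S x \<le> \<kappa> * u x}"
  proof -
    have "(\<forall>x\<in>Q. u x \<le> w S x \<and> w S x \<le> \<kappa> * u x)
        \<longleftrightarrow> (\<forall>x \<in> carrier_vec d. u x \<le> w S x \<and> w S x \<le> \<kappa> * u x)" for S
    proof
      assume *: "\<forall>x\<in>Q. u x \<le> w S x \<and> w S x \<le> \<kappa> * u x"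
      show "\<forall>x \<in> carrier_vec d. u x \<le> w S x \<and> w S x \<le> \<kappa> * u x"
        by (rule ballI, rule dense[OF *])
    next
      have "Q \<subseteq> carrier_vec d" unfolding Q_def by blast
      moreover assume "\<forall>x \<in> carrier_vec d. u x \<le> w S x \<and> w S x \<le> \<kappa> * u x"
      ultimately show "\<forall>x\<in>Q. u x \<le> w S x \<and> w S x \<le> \<kappa> * u x" by blast
    qed
    then show ?thesis by (simp only: space_borel_mat)
  qed
  also have "\<dots> = {S \<in> carrier_mat r n. \<forall>x \<in> carrier_vec d.
      lp_norm p (A *\<^sub>v x) \<le> lp_norm p (S * A *\<^sub>v x) \<and>
      lp_norm p (S * A *\<^sub>v x) \<le> \<kappa> * lp_norm p (A *\<^sub>v x)}"
    by (intro Collect_cong conj_cong ball_cong refl) (simp_all add: u w)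
  finally show ?thesis .
qed

definition scaled_stable_mat :: "real \<Rightarrow> nat \<Rightarrow> nat \<Rightarrow> nat \<Rightarrow> real \<Rightarrow> (nat \<Rightarrow> nat \<Rightarrow> int) \<Rightarrow> real mat" where
  "scaled_stable_mat p N r n \<sigma> F = mat r n (\<lambda>(i, k). stable_val p N (F i k) / \<sigma>)"

lemma scaled_stable_mat_carrier [simp]: "scaled_stable_mat p N r n \<sigma> F \<in> carrier_mat r n"
  by (simp add: scaled_stable_mat_def)

lemma lin_psum_scaled_stable_mat:
  assumes A: "A \<in> carrier_mat n d" and \<sigma>: "\<sigma> > 0"
  shows "lin_psum p r d (\<lambda>i j. (scaled_stable_mat p N r n \<sigma> F * A) $$ (i, j)) y
    = (\<Sum>i<r. \<bar>stable_form p N n (\<lambda>k. \<Sum>j<d. y j * A $$ (k, j)) (F i)\<bar> powr p) / \<sigma> powr p"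
proof -
  have "(\<Sum>j<d. y j * (scaled_stable_mat p N r n \<sigma> F * A) $$ (i, j))
      = stable_form p N n (\<lambda>k. \<Sum>j<d. y j * A $$ (k, j)) (F i) / \<sigma>" if "i < r" for i
  proof -
    have "(\<Sum>j<d. y j * (scaled_stable_mat p N r n \<sigma> F * A) $$ (i, j))
        = (\<Sum>j<d. y j * (stable_form p N n (\<lambda>k. A $$ (k, j)) (F i) / \<sigma>))"
      using that A by (intro sum.cong refl)
        (simp add: scaled_stable_mat_def scalar_prod_def lessThan_atLeast0 stable_form_def sum_divide_distrib)
    also have "\<dots> = (\<Sum>j<d. y j * stable_form p N n (\<lambda>k. A $$ (k, j)) (F i)) / \<sigma>"
      by (simp add: sum_divide_distrib)
    finally show ?thesis by (simp add: stable_form_combination)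
  qed
  then have "\<bar>\<Sum>j<d. y j * (scaled_stable_mat p N r n \<sigma> F * A) $$ (i, j)\<bar> powr p
      = \<bar>stable_form p N n (\<lambda>k. \<Sum>j<d. y j * A $$ (k, j)) (F i)\<bar> powr p / \<sigma> powr p" if "i < r" for i
    using that \<sigma> by (simp add: abs_divide powr_divide)
  then show ?thesis by (simp add: lin_psum_def sum_divide_distrib)
qed

text \<open>Dividing by \<open>\<sigma>\<close> with \<open>\<sigma> powr p = real r / 768\<close>
  normalises the contraction constant to 1. The distortion is then the p-th root of the quotient of
  the dilation and contraction constants, in which \<open>r\<close> cancels.\<close>

lemma stable_embedding:
  assumes p: "1 \<le> p" "p < 2" and n: "n > 0" and d: "d > 0" and r: "r > 0"
    and c: "c = 1 + 2 powr (2 / p) / (2 / p - 1)"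
    and J: "2 ^ J \<ge> 1000 * c * real r"
    and M: "real M \<ge> 4000000 * (real d)\<^sup>2 * (1 + 2 * c * real J)"
    and net: "real (2 * M + 1) ^ d * exp (- (real r / 24)) \<le> 1 / 500"
  shows "\<exists>D. oblivious_lp_subspace_embedding p n d r
    ((768 * 4000 * real d * (1 + 2 * c * real J)) powr (1 / p)) D"
proof -
  define N where "N = 2 * n"
  define Q where "Q = stable_mat_pmf r n N"
  define \<sigma> where "\<sigma> = (real r / 768) powr (1 / p)"
  define H where "H = 768 * 4000 * real d * (1 + 2 * c * real J)"
  define \<kappa> where "\<kappa> = H powr (1 / p)"
  define D where "D = distr (measure_pmf Q) (borel_mat r n) (scaled_stable_mat p N r n \<sigma>)"
  have p0: "p > 0" using p by simp
  have c1: "c \<ge> 1" using p by (simp add: c field_simps)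
  have H0: "H \<ge> 0" unfolding H_def using c1 by simp
  have \<sigma>: "\<sigma> > 0" "\<sigma> powr p = real r / 768"
    using r p0 by (simp_all add: \<sigma>_def powr_powr)
  have meas: "scaled_stable_mat p N r n \<sigma> \<in> measurable (measure_pmf Q) (borel_mat r n)"
    by (simp add: measurable_def Pi_def)
  have "oblivious_lp_subspace_embedding p n d r \<kappa> D"
    unfolding oblivious_lp_subspace_embedding_def
  proof (intro conjI ballI)
    show "prob_space D"
      unfolding D_def using meas by (intro prob_space.prob_space_distr) (auto intro: measure_pmf.prob_space_axioms)
    show "space D = carrier_mat r n" "sets D = sets (borel_mat r n)"
      by (simp_all add: D_def)
    fix A :: "real mat" assume A: "A \<in> carrier_mat n d"
    define E where "E = {S \<in> carrier_mat r n. \<forall>x \<in> carrier_vec d.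
      lp_norm p (A *\<^sub>v x) \<le> lp_norm p (S * A *\<^sub>v x) \<and>
      lp_norm p (S * A *\<^sub>v x) \<le> \<kappa> * lp_norm p (A *\<^sub>v x)}"
    define G where "G = {F. \<forall>x. real r / 768 * lin_psum p n d (\<lambda>k j. A $$ (k, j)) x
              \<le> (\<Sum>i<r. \<bar>stable_form p N n (\<lambda>k. \<Sum>j<d. x j * A $$ (k, j)) (F i)\<bar> powr p)
          \<and> (\<Sum>i<r. \<bar>stable_form p N n (\<lambda>k. \<Sum>j<d. x j * A $$ (k, j)) (F i)\<bar> powr p)
              \<le> 4000 * real r * real d * (1 + 2 * c * real J) * lin_psum p n d (\<lambda>k j. A $$ (k, j)) x}"
    have "99 / 100 \<le> measure_pmf.prob Q G"
      unfolding Q_def G_def by (rule stable_mat_pmf_embedding[OF p n N_def d r c J M net])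
    also have "\<dots> \<le> measure_pmf.prob Q (scaled_stable_mat p N r n \<sigma> -` E)"
    proof (intro measure_pmf.finite_measure_mono subsetI vimageI2)
      fix F assume F: "F \<in> G"
      let ?S = "scaled_stable_mat p N r n \<sigma> F"
      show "?S \<in> E"
        unfolding E_def
      proof (intro CollectI conjI ballI)
        fix x :: "real Matrix.vec" assume x: "x \<in> carrier_vec d"
        define s where "s = lin_psum p n d (\<lambda>k j. A $$ (k, j)) (vec_index x)"
        define t where "t = lin_psum p r d (\<lambda>i j. (?S * A) $$ (i, j)) (vec_index x)"
        have nA: "lp_norm p (A *\<^sub>v x) = s powr (1 / p)"
          unfolding s_def using A x by (rule lp_norm_mult_mat_vec)
        have nS: "lp_norm p (?S * A *\<^sub>v x) = t powr (1 / p)"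
          unfolding t_def using A x by (intro lp_norm_mult_mat_vec mult_carrier_mat[of _ r n]) auto
        have t: "t = (\<Sum>i<r. \<bar>stable_form p N n (\<lambda>k. \<Sum>j<d. vec_index x j * A $$ (k, j)) (F i)\<bar> powr p) / (real r / 768)"
          unfolding t_def by (subst lin_psum_scaled_stable_mat[OF A \<sigma>(1)]) (simp only: \<sigma>(2))
        have "s \<le> t"
          using F r unfolding G_def t s_def by (simp add: field_simps)
        then show "lp_norm p (A *\<^sub>v x) \<le> lp_norm p (?S * A *\<^sub>v x)"
          unfolding nA nS using p0 by (intro powr_mono2) (auto simp: s_def)
        have "t \<le> (4000 * real r * real d * (1 + 2 * c * real J) * s) / (real r / 768)"
          unfolding t s_def using F by (intro divide_right_mono) (auto simp: G_def)
        also have "\<dots> = H * s" using r by (simp add: H_def)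
        finally have "t powr (1 / p) \<le> (H * s) powr (1 / p)"
          using p0 by (intro powr_mono2) (auto simp: t_def)
        also have "\<dots> = \<kappa> * s powr (1 / p)"
          using H0 by (simp add: powr_mult \<kappa>_def s_def)
        finally show "lp_norm p (?S * A *\<^sub>v x) \<le> \<kappa> * lp_norm p (A *\<^sub>v x)"
          unfolding nA nS .
      qed simp
    qed simp
    also have "\<dots> = measure D E"
      unfolding D_def E_def using sets_embedding_event[OF A p0] meas
      by (subst measure_distr) auto
    finally show "99 / 100 \<le> measure D {S \<in> space D. \<forall>x \<in> carrier_vec d.
            lp_norm p (A *\<^sub>v x) \<le> lp_norm p (S * A *\<^sub>v x) \<and>
            lp_norm p (S * A *\<^sub>v x) \<le> \<kappa> * lp_norm p (A *\<^sub>v x)}"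
      unfolding E_def by (simp add: D_def)
  qed
  then show ?thesis unfolding \<kappa>_def H_def by blast
qed

theorem corollary1p12:
  fixes p :: real
  assumes "1 \<le> p" and "p < 2"
  shows "\<exists>C > 0. \<exists>c :: nat. \<forall>(n :: nat) (d :: nat). n \<ge> 1 \<longrightarrow> d \<ge> 1 \<longrightarrow>
    (\<exists>(r :: nat) (\<kappa> :: real) (D :: real mat measure).
       oblivious_lp_subspace_embedding p n d r \<kappa> D \<and>
       \<kappa> \<le> (C * (real d * log1 (real d) * log1 (log1 (real d)))) powr (1 / p) \<and>
       \<kappa> \<le> C * (real d powr (1 / p) * log1 (real d) ^ c) \<and>
       real r \<le> C * (real d * log1 (real d)))"
proof -
  define c where "c = 1 + 2 powr (2 / p) / (2 / p - 1)"
  have c1: "c \<ge> 1" using assms by (simp add: c_def field_simps)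
  obtain C where C: "C > 0" and param: "\<And>d::nat. d \<ge> 1 \<Longrightarrow> \<exists>r J M. r > 0
      \<and> real r \<le> C * (real d * log1 (real d)) \<and> real J \<le> C * log1 (real d)
      \<and> 2 ^ J \<ge> 1000 * c * real r
      \<and> real M \<ge> 4000000 * (real d)\<^sup>2 * (1 + 2 * c * real J)
      \<and> real (2 * M + 1) ^ d * exp (- (real r / 24)) \<le> 1 / 500"
    using embedding_parameters[OF c1] by metis
  \<comment> \<open>One summand serves the distortion and the other the number of rows. That
    \<open>C'\<close> is at least 1 gives \<open>C' powr (1 / p) \<le> C'\<close>.\<close>
  define C' where "C' = 768 * 4000 * (1 + 2 * c * C) + C"
  have C': "C' \<ge> 1" "C' \<ge> C" "C' \<ge> 768 * 4000 * (1 + 2 * c * C)"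
    using c1 C by (auto simp: C'_def add_increasing2 add_increasing)
  show ?thesis
  proof (rule exI[of _ C'], rule conjI, goal_cases)
    case 1
    show ?case using C' by simp
  next
    case 2
    show ?case
    \<comment> \<open>A single power of the logarithm dominates \<open>L powr (1 / p)\<close>, since
      \<open>L \<ge> 1\<close> and \<open>1 / p \<le> 1\<close>.\<close>
    proof (rule exI[of _ "1::nat"], intro allI impI)
    fix n d :: nat assume n: "n \<ge> 1" and d: "d \<ge> 1"
    obtain r J M where r: "r > 0" "real r \<le> C * (real d * log1 (real d))"
      and J: "real J \<le> C * log1 (real d)" "2 ^ J \<ge> 1000 * c * real r"
      and M: "real M \<ge> 4000000 * (real d)\<^sup>2 * (1 + 2 * c * real J)"
      and net: "real (2 * M + 1) ^ d * exp (- (real r / 24)) \<le> 1 / 500"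
      using param[OF d] by blast
    define L where "L = log1 (real d)"
    have L: "L \<ge> 1" by (simp add: L_def log1_ge_1)
    have d1: "real d \<ge> 1" using d by simp
    define H where "H = 768 * 4000 * real d * (1 + 2 * c * real J)"
    obtain D where D: "oblivious_lp_subspace_embedding p n d r (H powr (1 / p)) D"
      using stable_embedding[OF assms _ _ r(1) c_def J(2) M net, of n] n d unfolding H_def by auto
    have H0: "H \<ge> 0" using c1 by (simp add: H_def)
    have "2 * c * real J \<le> 2 * c * (C * L)" using J c1 by (intro mult_left_mono) (auto simp: L_def)
    then have "1 + 2 * c * real J \<le> (1 + 2 * c * C) * L" using L by (simp add: algebra_simps)
    then have "768 * 4000 * real d * (1 + 2 * c * real J) \<le> 768 * 4000 * real d * ((1 + 2 * c * C) * L)"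
      by (intro mult_left_mono) auto
    also have "\<dots> = (768 * 4000 * (1 + 2 * c * C)) * (real d * L)" by simp
    also have "\<dots> \<le> C' * (real d * L)"
      using C' L by (intro mult_right_mono) auto
    finally have H: "H \<le> C' * (real d * L)" by (simp add: H_def)
    \<comment> \<open>The construction yields \<open>H\<close> of order d log d; since
      \<open>log1\<close> is at least 1, this is within the stated bound.\<close>
    have "C' * (real d * L) * 1 \<le> C' * (real d * L) * log1 L"
      using C' L log1_ge_1 by (intro mult_left_mono) auto
    with H have H2: "H \<le> C' * (real d * L * log1 L)" by (simp add: mult.assoc)
    have k1: "H powr (1 / p) \<le> (C' * (real d * L * log1 L)) powr (1 / p)"
      using H0 H2 assms by (intro powr_mono2) auto
    have le_self: "z powr (1 / p) \<le> z" if "z \<ge> 1" for z :: real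
      using powr_mono[of "1 / p" 1 z] that assms by simp
    have "H powr (1 / p) \<le> (C' * (real d * L)) powr (1 / p)"
      using H0 H assms by (intro powr_mono2) auto
    also have "\<dots> = C' powr (1 / p) * (real d powr (1 / p) * L powr (1 / p))"
      using C' L by (simp add: powr_mult)
    also have "\<dots> \<le> C' * (real d powr (1 / p) * L)"
      using C' L le_self by (intro mult_mono mult_left_mono) auto
    finally have k2: "H powr (1 / p) \<le> C' * (real d powr (1 / p) * L ^ 1)" by simp
    have "real r \<le> C' * (real d * L)"
      using r(2) C'(2) L unfolding L_def[symmetric] by (meson mult_right_mono mult_nonneg_nonneg of_nat_0_le_iff order_trans zero_le_one)
    with D k1 k2 show "\<exists>(r :: nat) (\<kappa> :: real) (D :: real mat measure).
       oblivious_lp_subspace_embedding p n d r \<kappa> D \<and>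
       \<kappa> \<le> (C' * (real d * log1 (real d) * log1 (log1 (real d)))) powr (1 / p) \<and>
       \<kappa> \<le> C' * (real d powr (1 / p) * log1 (real d) ^ 1) \<and>
       real r \<le> C' * (real d * log1 (real d))"
      unfolding L_def by blast
    qed
  qed
qed

end
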